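(* $DQ\Lambda\cong\mathrm{DQSym}$ as Hopf algebras.
   Context: Work over a field $\mathbb{K}$. $[\bar n,n]=\{\bar n,\dots,\bar1,1,\dots,n\}$, elements $\bar i$ negative, $i$ positive. A section is $s:[n]\to[\bar n,n]$ with $s(i)\in\{i,\bar i\}$. A set composition of a finite set $X$ is an ordered list $F_1|\cdots|F_k$ of nonempty disjoint subsets with union $X$; for $Y\subseteq X$, $F|_Y=F_1\cap Y|\cdots|F_k\cap Y$ with empty blocks deleted. For set compositions $F\models X$, $G\models Y$ with $X\cap Y=\emptyset$, a quasishuffle of $F$ and $G$ is a set composition $H$ of $X\cup Y$ with $H|_X=F$ and $H|_Y=G$ (equivalently: interleave the blocks of $F$ and $G$ preserving their orders, possibly merging adjacent pairs consisting of one block of $F$ and one block of $G$). The symmetric group $\mathcal{S}_n$ acts on $[\bar n,n]$ by $\pi(\bar i)=\overline{\pi(i)}$, hence on set compositions of images $s([n])$ of sections. $DQ\Lambda$ is the graded vector space $\widetilde{K^{\mathcal{H}}}\circ\mathcal{S}(\ell^{*}\circ\mathsf{e}_+)=\bigoplus_{n\ge0}\big(\bigoplus_{s}\bigoplus_{F\models s([n])}\mathbb{K}F\big)_{\mathcal{S}_n}$, i.e. its degree-$n$ part has basis the $\mathcal{S}_n$-orbits $[F]$ of set compositions $F$ of sets $s([n])$, $s$ a section. Its Hopf algebra structure (induced from the Hopf monoid $\ell^*\circ\mathsf{e}_+$, whose product is quasishuffle and coproduct deconcatenation, through the bilax functors $\mathcal{S}$ and $\widetilde{K^{\mathcal{H}}}$)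 is: for $[F]$ of degree $n$ and $[G]$ of degree $m$, $[F]\cdot[G]=\sum_H[H]$ over all quasishuffles $H$ of $F$ and $G'$, where $G'$ is obtained from $G$ by replacing each $i$ by $n+i$ and each $\bar i$ by $\overline{n+i}$; and $\Delta[F_1|\cdots|F_k]=\sum_{i=0}^k[\mathrm{st}(F_1|\cdots|F_i)]\otimes[\mathrm{st}(F_{i+1}|\cdots|F_k)]$, where $\mathrm{st}$ relabels the underlying elements by the unique bijection to some $[\bar j,j]$ that preserves the order of absolute values and the signs; the unit is the empty composition in degree $0$. $\mathrm{DQSym}$ is the Hopf algebra with basis $\{M_c\}$ indexed by bicompositions $c$ (finite lists of columns $\binom{\alpha_i}{\beta_i}$ of nonnegative integers, each $\ne\binom00$; degree $\sum(\alpha_i+\beta_i)$, including the empty bicomposition), with product $M_aM_b=\sum_c M_c$ over all quasishuffles $c$ of $a$ and $b$ (interleavings of the columns of $a$ and $b$ preserving their orders, in which some adjacent pairs consisting of one column from $a$ and one from $b$ may be replaced by their sum $\binom{\alpha+\alpha'}{\beta+\beta'}$), and coproduct by deconcatenation $\Delta M_{c_1\cdots c_k}=\sum_{i=0}^kM_{c_1\cdots c_i}\otimes M_{c_{i+1}\cdots c_k}$. *)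

theory Defs
  imports Complex_Main "HOL-Library.Poly_Mapping" "HOL-Combinatorics.Permutations"
begin

section \<open>Free vector spaces and their tensor products\<close>

text \<open>The vector space with basis \<open>'b\<close> over the field \<open>'k\<close> is the type \<open>'b \<Rightarrow>\<^sub>0 'k\<close> of finitely
  supported functions. The tensor product of the spaces with bases \<open>'a\<close> and \<open>'b\<close> is the space with
  basis \<open>'a \<times> 'b\<close>, where \<open>(a, b)\<close> stands for the pure tensor of \<open>a\<close> and \<open>b\<close>. The multiplication
  that \<^theory>\<open>HOL-Library.Poly_Mapping\<close> puts on such types is not used.\<close>

definition bas :: "'b \<Rightarrow> ('b \<Rightarrow>\<^sub>0 'k::field)" where
  "bas b = Poly_Mapping.single b 1"

definition smult :: "'k::field \<Rightarrow> ('b \<Rightarrow>\<^sub>0 'k) \<Rightarrow> ('b \<Rightarrow>\<^sub>0 'k)" where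
  "smult c x = Poly_Mapping.map ((*) c) x"

abbreviation is_linear :: "(('a \<Rightarrow>\<^sub>0 'k::field) \<Rightarrow> ('b \<Rightarrow>\<^sub>0 'k)) \<Rightarrow> bool" where
  "is_linear \<equiv> Vector_Spaces.linear smult smult"

definition lin_ext :: "('a \<Rightarrow> ('b \<Rightarrow>\<^sub>0 'k::field)) \<Rightarrow> ('a \<Rightarrow>\<^sub>0 'k) \<Rightarrow> ('b \<Rightarrow>\<^sub>0 'k)" where
  "lin_ext f x = (\<Sum>a\<in>Poly_Mapping.keys x. smult (Poly_Mapping.lookup x a) (f a))"

definition bilin_ext ::
  "('a \<Rightarrow> 'b \<Rightarrow> ('c \<Rightarrow>\<^sub>0 'k::field)) \<Rightarrow> ('a \<Rightarrow>\<^sub>0 'k) \<Rightarrow> ('b \<Rightarrow>\<^sub>0 'k) \<Rightarrow> ('c \<Rightarrow>\<^sub>0 'k)" where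
  "bilin_ext f x y = lin_ext (\<lambda>a. lin_ext (f a) y) x"

definition tensor :: "('a \<Rightarrow>\<^sub>0 'k::field) \<Rightarrow> ('b \<Rightarrow>\<^sub>0 'k) \<Rightarrow> ('a \<times> 'b \<Rightarrow>\<^sub>0 'k)" where
  "tensor = bilin_ext (\<lambda>a b. bas (a, b))"

definition tensor_map ::
  "(('a \<Rightarrow>\<^sub>0 'k::field) \<Rightarrow> ('c \<Rightarrow>\<^sub>0 'k)) \<Rightarrow> (('b \<Rightarrow>\<^sub>0 'k) \<Rightarrow> ('d \<Rightarrow>\<^sub>0 'k)) \<Rightarrow>
    ('a \<times> 'b \<Rightarrow>\<^sub>0 'k) \<Rightarrow> ('c \<times> 'd \<Rightarrow>\<^sub>0 'k)" where
  "tensor_map f g = lin_ext (\<lambda>(a, b). tensor (f (bas a)) (g (bas b)))"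

definition tensor_assoc :: "(('a \<times> 'b) \<times> 'c \<Rightarrow>\<^sub>0 'k::field) \<Rightarrow> ('a \<times> 'b \<times> 'c \<Rightarrow>\<^sub>0 'k)" where
  "tensor_assoc = lin_ext (\<lambda>((a, b), c). bas (a, b, c))"


section \<open>Hopf algebras\<close>

record (overloaded) ('b, 'k) hopf_data =
  hmult :: "('b \<Rightarrow>\<^sub>0 'k::field) \<Rightarrow> ('b \<Rightarrow>\<^sub>0 'k) \<Rightarrow> ('b \<Rightarrow>\<^sub>0 'k)"
  hunit :: "'b \<Rightarrow>\<^sub>0 'k"
  hcomult :: "('b \<Rightarrow>\<^sub>0 'k) \<Rightarrow> ('b \<times> 'b \<Rightarrow>\<^sub>0 'k)"
  hcounit :: "('b \<Rightarrow>\<^sub>0 'k) \<Rightarrow> 'k"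

definition tensor_mult ::
  "('b, 'k::field) hopf_data \<Rightarrow> ('b \<times> 'b \<Rightarrow>\<^sub>0 'k) \<Rightarrow> ('b \<times> 'b \<Rightarrow>\<^sub>0 'k) \<Rightarrow> ('b \<times> 'b \<Rightarrow>\<^sub>0 'k)" where
  "tensor_mult A = bilin_ext
     (\<lambda>(a, b) (c, d). tensor (hmult A (bas a) (bas c)) (hmult A (bas b) (bas d)))"

definition mult_tensor :: "('b, 'k::field) hopf_data \<Rightarrow> ('b \<times> 'b \<Rightarrow>\<^sub>0 'k) \<Rightarrow> ('b \<Rightarrow>\<^sub>0 'k)" where
  "mult_tensor A = lin_ext (\<lambda>(a, b). hmult A (bas a) (bas b))"

definition is_algebra :: "('b, 'k::field) hopf_data \<Rightarrow> bool" where
  "is_algebra A \<longleftrightarrow>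
     (\<forall>x. is_linear (hmult A x)) \<and> (\<forall>y. is_linear (\<lambda>x. hmult A x y)) \<and>
     (\<forall>x y z. hmult A (hmult A x y) z = hmult A x (hmult A y z)) \<and>
     (\<forall>x. hmult A (hunit A) x = x \<and> hmult A x (hunit A) = x)"

text \<open>The counit laws identify the tensor product of \<open>'k\<close> and the space with the space itself.\<close>

definition is_coalgebra :: "('b, 'k::field) hopf_data \<Rightarrow> bool" where
  "is_coalgebra A \<longleftrightarrow>
     is_linear (hcomult A) \<and> Vector_Spaces.linear smult (*) (hcounit A) \<and>
     (\<forall>x. tensor_assoc (tensor_map (hcomult A) id (hcomult A x)) =
          tensor_map id (hcomult A) (hcomult A x)) \<and>
     (\<forall>x. lin_ext (\<lambda>(a, b). smult (hcounit A (bas a)) (bas b)) (hcomult A x) = x) \<and>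
     (\<forall>x. lin_ext (\<lambda>(a, b). smult (hcounit A (bas b)) (bas a)) (hcomult A x) = x)"

definition is_bialgebra :: "('b, 'k::field) hopf_data \<Rightarrow> bool" where
  "is_bialgebra A \<longleftrightarrow> is_algebra A \<and> is_coalgebra A \<and>
     (\<forall>x y. hcomult A (hmult A x y) = tensor_mult A (hcomult A x) (hcomult A y)) \<and>
     hcomult A (hunit A) = tensor (hunit A) (hunit A) \<and>
     (\<forall>x y. hcounit A (hmult A x y) = hcounit A x * hcounit A y) \<and>
     hcounit A (hunit A) = 1"

definition is_antipode ::
  "('b, 'k::field) hopf_data \<Rightarrow> (('b \<Rightarrow>\<^sub>0 'k) \<Rightarrow> ('b \<Rightarrow>\<^sub>0 'k)) \<Rightarrow> bool" where
  "is_antipode A S \<longleftrightarrow> is_linear S \<and>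
     (\<forall>x. mult_tensor A (tensor_map S id (hcomult A x)) = smult (hcounit A x) (hunit A)) \<and>
     (\<forall>x. mult_tensor A (tensor_map id S (hcomult A x)) = smult (hcounit A x) (hunit A))"

definition is_hopf_algebra :: "('b, 'k::field) hopf_data \<Rightarrow> bool" where
  "is_hopf_algebra A \<longleftrightarrow> is_bialgebra A \<and> (\<exists>S. is_antipode A S)"

text \<open>A bialgebra has at most one antipode, and bialgebra morphisms between Hopf algebras commute
  with the antipodes; so no condition on antipodes is imposed on isomorphisms.\<close>

definition is_hopf_iso ::
  "('a, 'k::field) hopf_data \<Rightarrow> ('b, 'k) hopf_data \<Rightarrow> (('a \<Rightarrow>\<^sub>0 'k) \<Rightarrow> ('b \<Rightarrow>\<^sub>0 'k)) \<Rightarrow> bool" where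
  "is_hopf_iso A B \<phi> \<longleftrightarrow> is_hopf_algebra A \<and> is_hopf_algebra B \<and>
     is_linear \<phi> \<and> bij \<phi> \<and>
     (\<forall>x y. \<phi> (hmult A x y) = hmult B (\<phi> x) (\<phi> y)) \<and>
     \<phi> (hunit A) = hunit B \<and>
     (\<forall>x. hcomult B (\<phi> x) = tensor_map \<phi> \<phi> (hcomult A x)) \<and>
     (\<forall>x. hcounit B (\<phi> x) = hcounit A x)"

definition homogeneous :: "('b \<Rightarrow> nat) \<Rightarrow> nat \<Rightarrow> ('b \<Rightarrow>\<^sub>0 'k::field) set" where
  "homogeneous deg n = {x. \<forall>b\<in>Poly_Mapping.keys x. deg b = n}"


section \<open>Set compositions of signed sets\<close>

text \<open>The element \<open>i\<close> with a bar is represented by the integer \<open>-i\<close>.\<close>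

definition is_section :: "nat \<Rightarrow> (int \<Rightarrow> int) \<Rightarrow> bool" where
  "is_section n s \<longleftrightarrow> (\<forall>i\<in>{1..int n}. s i \<in> {i, - i})"

definition set_composition :: "'a set \<Rightarrow> 'a set list \<Rightarrow> bool" where
  "set_composition X F \<longleftrightarrow> {} \<notin> set F \<and> sorted_wrt disjnt F \<and> \<Union>(set F) = X"

definition signed_composition :: "nat \<Rightarrow> int set list \<Rightarrow> bool" where
  "signed_composition n F \<longleftrightarrow> (\<exists>s. is_section n s \<and> set_composition (s ` {1..int n}) F)"

definition restrict_comp :: "'a set list \<Rightarrow> 'a set \<Rightarrow> 'a set list" where
  "restrict_comp F Y = filter (\<lambda>B. B \<noteq> {}) (map (\<lambda>B. B \<inter> Y) F)"

definition set_quasishuffles :: "'a set list \<Rightarrow> 'a set list \<Rightarrow> 'a set list set" where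
  "set_quasishuffles F G = {H. set_composition (\<Union>(set F) \<union> \<Union>(set G)) H \<and>
     restrict_comp H (\<Union>(set F)) = F \<and> restrict_comp H (\<Union>(set G)) = G}"

definition signed_act :: "(int \<Rightarrow> int) \<Rightarrow> int \<Rightarrow> int" where
  "signed_act \<pi> x = sgn x * \<pi> \<bar>x\<bar>"

definition relabel :: "('a \<Rightarrow> 'b) \<Rightarrow> 'a set list \<Rightarrow> 'b set list" where
  "relabel f F = map (image f) F"

definition signed_shift :: "nat \<Rightarrow> int \<Rightarrow> int" where
  "signed_shift n x = sgn x * (\<bar>x\<bar> + int n)"

definition standardize :: "int set list \<Rightarrow> int set list" where
  "standardize F =
     relabel (\<lambda>x. sgn x * int (card {y \<in> \<Union>(set F). \<bar>y\<bar> \<le> \<bar>x\<bar>})) F"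

definition same_orbit :: "int set list \<Rightarrow> int set list \<Rightarrow> bool" where
  "same_orbit F G \<longleftrightarrow> (\<exists>n. signed_composition n F \<and>
     (\<exists>\<pi>. \<pi> permutes {1..int n} \<and> G = relabel (signed_act \<pi>) F))"


subsection \<open>Independence of representatives\<close>

lemma Union_relabel [simp]: "\<Union>(set (relabel f F)) = f ` \<Union>(set F)"
  by (auto simp: relabel_def)

lemma relabel_Nil [simp]: "relabel f [] = []"
  by (simp add: relabel_def)

lemma relabel_relabel: "relabel f (relabel g F) = relabel (\<lambda>x. f (g x)) F"
  by (simp add: relabel_def image_image)

lemma relabel_cong: "(\<And>x. x \<in> \<Union>(set F) \<Longrightarrow> f x = g x) \<Longrightarrow> relabel f F = relabel g F"
  unfolding relabel_def by (intro map_cong refl image_cong) auto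

lemma relabel_ident: "(\<And>x. x \<in> \<Union>(set F) \<Longrightarrow> f x = x) \<Longrightarrow> relabel f F = F"
  using relabel_cong[of F f "\<lambda>x. x"] by (simp add: relabel_def cong: map_cong)

lemma relabel_inv_into:
  assumes "inj_on f X" "\<Union>(set F) \<subseteq> X"
  shows "relabel (inv_into X f) (relabel f F) = F"
  unfolding relabel_relabel using assms by (intro relabel_ident inv_into_f_f) auto

lemma set_composition_relabel:
  assumes "set_composition X F" "inj_on f X"
  shows "set_composition (f ` X) (relabel f F)"
proof -
  have U: "\<Union>(set F) = X" using assms by (simp add: set_composition_def)
  have "sorted_wrt (\<lambda>A B. disjnt (f ` A) (f ` B)) F"
  proof (rule sorted_wrt_mono_rel)
    show "sorted_wrt disjnt F" using assms by (simp add: set_composition_def)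
    fix A B assume "A \<in> set F" "B \<in> set F" "disjnt A B"
    then show "disjnt (f ` A) (f ` B)"
      using assms(2) U unfolding disjnt_def inj_on_def by blast
  qed
  then show ?thesis
    using assms U Union_relabel[of f F]
    unfolding set_composition_def by (auto simp: relabel_def sorted_wrt_map)
qed

lemma restrict_comp_relabel:
  assumes "inj_on f X" "\<Union>(set F) \<subseteq> X" "Y \<subseteq> X"
  shows "restrict_comp (relabel f F) (f ` Y) = relabel f (restrict_comp F Y)"
proof -
  have "f ` B \<inter> f ` Y = f ` (B \<inter> Y)" if "B \<in> set F" for B
    using assms that by (metis Union_upper inj_on_image_Int order_trans)
  then have "map (\<lambda>B. B \<inter> f ` Y) (relabel f F) = map (image f) (map (\<lambda>B. B \<inter> Y) F)"
    by (simp add: relabel_def)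
  then show ?thesis
    by (simp add: restrict_comp_def relabel_def filter_map comp_def del: map_map)
qed

lemma set_quasishuffles_relabel:
  assumes "inj_on f (\<Union>(set F) \<union> \<Union>(set G))" "H \<in> set_quasishuffles F G"
  shows "relabel f H \<in> set_quasishuffles (relabel f F) (relabel f G)"
proof -
  let ?X = "\<Union>(set F) \<union> \<Union>(set G)"
  have H: "set_composition ?X H" "restrict_comp H (\<Union>(set F)) = F"
    "restrict_comp H (\<Union>(set G)) = G"
    using assms(2) by (auto simp: set_quasishuffles_def)
  have U: "\<Union>(set H) = ?X" using H(1) by (simp add: set_composition_def)
  have "set_composition (f ` ?X) (relabel f H)"
    by (rule set_composition_relabel[OF H(1) assms(1)])
  then show ?thesis
    using restrict_comp_relabel[OF assms(1), of H "\<Union>(set F)"]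
      restrict_comp_relabel[OF assms(1), of H "\<Union>(set G)"] U H
    by (simp add: set_quasishuffles_def image_Un)
qed

lemma signed_composition_iff:
  "signed_composition n F \<longleftrightarrow>
     set_composition (\<Union>(set F)) F \<and> bij_betw abs (\<Union>(set F)) {1..int n}"
proof
  assume "signed_composition n F"
  then obtain s where s: "is_section n s" "set_composition (s ` {1..int n}) F"
    by (auto simp: signed_composition_def)
  have U: "\<Union>(set F) = s ` {1..int n}" using s by (simp add: set_composition_def)
  have a: "\<bar>s i\<bar> = i" if "i \<in> {1..int n}" for i
    using s(1) that unfolding is_section_def by force
  have "bij_betw abs (s ` {1..int n}) {1..int n}"
    by (rule bij_betw_byWitness[where f' = s]) (use a in auto)
  then show "set_composition (\<Union>(set F)) F \<and> bij_betw abs (\<Union>(set F)) {1..int n}"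
    using s U by simp
next
  assume *: "set_composition (\<Union>(set F)) F \<and> bij_betw abs (\<Union>(set F)) {1..int n}"
  define s where "s = inv_into (\<Union>(set F)) (abs :: int \<Rightarrow> int)"
  have "\<bar>s i\<bar> = i" if "i \<in> {1..int n}" for i
    using * that unfolding s_def by (meson bij_betw_inv_into_right)
  then have "is_section n s"
    unfolding is_section_def by (force simp: abs_if split: if_splits)
  moreover have "s ` {1..int n} = \<Union>(set F)"
    using * unfolding s_def by (meson bij_betw_def bij_betw_inv_into)
  ultimately show "signed_composition n F"
    using * unfolding signed_composition_def by auto
qed

lemma signed_composition_card: "signed_composition n F \<Longrightarrow> card (\<Union>(set F)) = n"
  using bij_betw_same_card by (fastforce simp: signed_composition_iff)

lemma abs_sgn_mult: "x \<noteq> 0 \<Longrightarrow> 0 \<le> y \<Longrightarrow> \<bar>sgn x * y\<bar> = (y::int)"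
  by (simp add: abs_mult)

lemma same_orbit_iff:
  "same_orbit F G \<longleftrightarrow> (\<exists>n h. signed_composition n F \<and> signed_composition n G \<and>
     inj_on h (\<Union>(set F)) \<and> (\<forall>x\<in>\<Union>(set F). sgn (h x) = sgn x) \<and> G = relabel h F)"
  (is "_ \<longleftrightarrow> ?R")
proof
  assume "same_orbit F G"
  then obtain n p where F: "signed_composition n F" and p: "p permutes {1..int n}"
    and G: "G = relabel (signed_act p) F" by (auto simp: same_orbit_def)
  let ?U = "\<Union>(set F)"
  have bF: "bij_betw abs ?U {1..int n}" and cF: "set_composition ?U F"
    using F by (auto simp: signed_composition_iff)
  have r: "\<bar>x\<bar> \<in> {1..int n}" if "x \<in> ?U" for x
    using bF that by (meson bij_betwE)
  have pr: "p \<bar>x\<bar> \<in> {1..int n}" if "x \<in> ?U" for x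
    using r[OF that] permutes_in_image[OF p] by blast
  have ab: "\<bar>signed_act p x\<bar> = p \<bar>x\<bar>" if "x \<in> ?U" for x
    using r[OF that] pr[OF that] unfolding signed_act_def by (intro abs_sgn_mult) auto
  have sg: "sgn (signed_act p x) = sgn x" if "x \<in> ?U" for x
    using pr[OF that] by (simp add: signed_act_def sgn_mult)
  have "bij_betw p {1..int n} {1..int n}" using p by (rule permutes_imp_bij)
  then have "bij_betw (p \<circ> abs) ?U {1..int n}" using bF by (rule bij_betw_trans[rotated])
  then have b: "bij_betw (abs \<circ> signed_act p) ?U {1..int n}"
    using ab by (subst bij_betw_cong[where g = "p \<circ> abs"]) auto
  then have i: "inj_on (signed_act p) ?U"
    by (meson bij_betw_def inj_on_imageI2)
  have "bij_betw abs (signed_act p ` ?U) {1..int n}"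
    using b by (simp add: bij_betw_def inj_on_imageI image_comp)
  moreover have "set_composition (signed_act p ` ?U) G"
    using set_composition_relabel[OF cF i] G by simp
  ultimately have "signed_composition n G"
    using G by (simp add: signed_composition_iff)
  then show ?R using F G i sg by blast
next
  assume ?R
  then obtain n h where F: "signed_composition n F" and Gc: "signed_composition n G"
    and i: "inj_on h (\<Union>(set F))" and sg: "\<And>x. x \<in> \<Union>(set F) \<Longrightarrow> sgn (h x) = sgn x"
    and G: "G = relabel h F" by blast
  let ?U = "\<Union>(set F)"
  define q where "q = inv_into ?U (abs :: int \<Rightarrow> int)"
  define p where "p j = (if j \<in> {1..int n} then \<bar>h (q j)\<bar> else j)" for j
  have bF: "bij_betw abs ?U {1..int n}" using F by (auto simp: signed_composition_iff)
  have bG: "bij_betw abs (h ` ?U) {1..int n}" using Gc G by (simp add: signed_composition_iff)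
  have "bij_betw q {1..int n} ?U" unfolding q_def by (rule bij_betw_inv_into[OF bF])
  moreover have "bij_betw h ?U (h ` ?U)" using i by (simp add: bij_betw_def)
  ultimately have "bij_betw (abs \<circ> (h \<circ> q)) {1..int n} {1..int n}"
    using bG by (blast intro: bij_betw_trans)
  then have "bij_betw p {1..int n} {1..int n}"
    by (subst bij_betw_cong[where g = "abs \<circ> (h \<circ> q)"]) (auto simp: p_def)
  then have "p permutes {1..int n}" by (rule bij_imp_permutes) (auto simp: p_def)
  moreover have "G = relabel (signed_act p) F"
    unfolding G
  proof (rule relabel_cong)
    fix x assume x: "x \<in> ?U"
    have "\<bar>x\<bar> \<in> {1..int n}" using bF x by (meson bij_betwE)
    moreover have "q \<bar>x\<bar> = x" unfolding q_def using bF x by (simp add: bij_betw_inv_into_left)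
    ultimately have "signed_act p x = sgn (h x) * \<bar>h x\<bar>"
      using sg[OF x] by (simp add: signed_act_def p_def)
    then show "h x = signed_act p x" by (simp add: sgn_mult_abs)
  qed
  ultimately show "same_orbit F G" using F unfolding same_orbit_def by blast
qed

lemma same_orbitI:
  assumes "signed_composition n F" "signed_composition n (relabel h F)"
    "inj_on h (\<Union>(set F))" "\<And>x. x \<in> \<Union>(set F) \<Longrightarrow> sgn (h x) = sgn x"
  shows "same_orbit F (relabel h F)"
  unfolding same_orbit_iff using assms by blast

lemma same_orbit_refl: "signed_composition n F \<Longrightarrow> same_orbit F F"
  using same_orbitI[of n F "\<lambda>x. x"] by (simp add: relabel_ident)

lemma same_orbit_sym: assumes "same_orbit F G" shows "same_orbit G F"
proof -
  from assms obtain n h where F: "signed_composition n F" and Gc: "signed_composition n G"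
    and i: "inj_on h (\<Union>(set F))" and sg: "\<And>x. x \<in> \<Union>(set F) \<Longrightarrow> sgn (h x) = sgn x"
    and G: "G = relabel h F" unfolding same_orbit_iff by blast
  let ?g = "inv_into (\<Union>(set F)) h"
  have "relabel ?g G = F"
    unfolding G relabel_relabel using i by (intro relabel_ident) auto
  moreover have "same_orbit G (relabel ?g G)"
  proof (rule same_orbitI)
    show "signed_composition n G" "signed_composition n (relabel ?g G)"
      using Gc F \<open>relabel ?g G = F\<close> by simp_all
    show "inj_on ?g (\<Union>(set G))" using G by (simp add: inj_on_inv_into)
    show "sgn (?g x) = sgn x" if x: "x \<in> \<Union>(set G)" for x
    proof -
      obtain y where y: "y \<in> \<Union>(set F)" "x = h y" using x unfolding G Union_relabel by blast
      then have "?g x = y" using i by (simp only: inv_into_f_f)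
      then show ?thesis using sg y by simp
    qed
  qed
  ultimately show ?thesis by simp
qed

lemma same_orbit_trans: assumes "same_orbit F G" "same_orbit G H" shows "same_orbit F H"
proof -
  from assms(1) obtain n h where F: "signed_composition n F" and Gc: "signed_composition n G"
    and i: "inj_on h (\<Union>(set F))" and sg: "\<And>x. x \<in> \<Union>(set F) \<Longrightarrow> sgn (h x) = sgn x"
    and G: "G = relabel h F" unfolding same_orbit_iff by blast
  from assms(2) obtain m g where Gm: "signed_composition m G" and Hc: "signed_composition m H"
    and i': "inj_on g (\<Union>(set G))" and sg': "\<And>x. x \<in> \<Union>(set G) \<Longrightarrow> sgn (g x) = sgn x"
    and H: "H = relabel g G" unfolding same_orbit_iff by blast
  have "m = n" using Gc Gm signed_composition_card by blast
  have "H = relabel (\<lambda>x. g (h x)) F" by (simp add: H G relabel_relabel)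
  moreover have "inj_on (\<lambda>x. g (h x)) (\<Union>(set F))"
    using comp_inj_on[OF i, of g] i' G by (simp add: comp_def)
  moreover have "\<forall>x\<in>\<Union>(set F). sgn (g (h x)) = sgn x" using sg sg' G by auto
  ultimately show ?thesis
    unfolding same_orbit_iff using F Hc \<open>m = n\<close> by blast
qed

lemma signed_composition_Nil: "signed_composition 0 []"
  by (simp add: signed_composition_def set_composition_def is_section_def)

lemma signed_shift_props:
  assumes "x \<noteq> 0"
  shows "\<bar>signed_shift n x\<bar> = \<bar>x\<bar> + int n" "sgn (signed_shift n x) = sgn x"
  using assms by (auto simp: signed_shift_def abs_mult sgn_mult)

lemma inj_signed_shift: "inj (signed_shift n)"
proof (rule injI)
  fix x y assume e: "signed_shift n x = signed_shift n y"
  have z: "signed_shift n u = 0 \<longleftrightarrow> u = 0" for u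
    using signed_shift_props(1)[of u n] by (cases "u = 0") (auto simp: signed_shift_def)
  show "x = y"
  proof (cases "x = 0 \<or> y = 0")
    case True
    then show ?thesis using z[of x] z[of y] e by auto
  next
    case False
    then have "\<bar>x\<bar> = \<bar>y\<bar>" "sgn x = sgn y"
      using signed_shift_props[of x n] signed_shift_props[of y n] e by auto
    then show ?thesis by (metis sgn_mult_abs)
  qed
qed

lemma signed_composition_range:
  "signed_composition n F \<Longrightarrow> x \<in> \<Union>(set F) \<Longrightarrow> \<bar>x\<bar> \<in> {1..int n}"
  unfolding signed_composition_iff by (meson bij_betwE)

lemma set_quasishuffles_Union:
  "H \<in> set_quasishuffles F G \<Longrightarrow> \<Union>(set H) = \<Union>(set F) \<union> \<Union>(set G)"
  by (simp add: set_quasishuffles_def set_composition_def)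

lemma signed_composition_quasishuffle:
  assumes F: "signed_composition n F" and G: "signed_composition m G"
    and H: "H \<in> set_quasishuffles F (relabel (signed_shift n) G)"
  shows "signed_composition (n + m) H"
proof -
  let ?U = "\<Union>(set F)" and ?V = "\<Union>(set G)"
  have U: "\<Union>(set H) = ?U \<union> signed_shift n ` ?V" using set_quasishuffles_Union[OF H] by simp
  have bU: "bij_betw abs ?U {1..int n}" and bV: "bij_betw abs ?V {1..int m}"
    using F G by (auto simp: signed_composition_iff)
  have nz: "x \<noteq> 0" if "x \<in> ?V" for x using signed_composition_range[OF G that] by auto
  have "bij_betw (\<lambda>x. x + int n) {1..int m} {int n + 1..int n + int m}"
    by (rule bij_betw_byWitness[where f' = "\<lambda>x. x - int n"]) auto
  then have "bij_betw ((\<lambda>x. x + int n) \<circ> abs) ?V {int n + 1..int n + int m}"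
    using bV bij_betw_trans by blast
  then have "bij_betw (abs \<circ> signed_shift n) ?V {int n + 1..int n + int m}"
    using nz by (subst bij_betw_cong[where g = "(\<lambda>x. x + int n) \<circ> abs"])
      (auto simp: signed_shift_props)
  then have "bij_betw abs (signed_shift n ` ?V) {int n + 1..int n + int m}"
    by (simp add: bij_betw_def inj_on_imageI image_comp)
  then have "bij_betw abs (?U \<union> signed_shift n ` ?V) ({1..int n} \<union> {int n + 1..int n + int m})"
    using bU by (intro bij_betw_combine) auto
  moreover have "{1..int n} \<union> {int n + 1..int n + int m} = {1..int (n + m)}" by auto
  ultimately have "bij_betw abs (\<Union>(set H)) {1..int (n + m)}" using U by simp
  moreover have "set_composition (\<Union>(set H)) H"
    using H by (auto simp: set_quasishuffles_def set_composition_def)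
  ultimately show ?thesis by (simp add: signed_composition_iff)
qed

lemma signed_composition_segment:
  assumes F: "signed_composition n F" and D: "D = take i F \<or> D = drop i F"
  shows "signed_composition (card (\<Union>(set D))) (standardize D)"
    and "inj_on (\<lambda>x. sgn x * int (card {y \<in> \<Union>(set D). \<bar>y\<bar> \<le> \<bar>x\<bar>})) (\<Union>(set D))"
    and "\<And>x. x \<in> \<Union>(set D) \<Longrightarrow>
      sgn (sgn x * int (card {y \<in> \<Union>(set D). \<bar>y\<bar> \<le> \<bar>x\<bar>})) = sgn x"
proof -
  let ?D = "\<Union>(set D)"
  define r where "r x = card {y \<in> ?D. \<bar>y\<bar> \<le> \<bar>x\<bar>}" for x :: int
  define f where "f x = sgn x * int (r x)" for x :: int
  have sub: "set D \<subseteq> set F" using D set_take_subset set_drop_subset by metis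
  then have subU: "?D \<subseteq> \<Union>(set F)" by blast
  have bF: "bij_betw abs (\<Union>(set F)) {1..int n}" and cF: "set_composition (\<Union>(set F)) F"
    using F by (auto simp: signed_composition_iff)
  have inj: "inj_on abs ?D" using bF subU by (meson bij_betw_def inj_on_subset)
  have nz: "x \<noteq> 0" if "x \<in> ?D" for x
    using signed_composition_range[OF F] subU that by fastforce
  have fin: "finite ?D"
    using bF subU by (meson bij_betw_finite finite_atLeastAtMost_int finite_subset)
  have cD: "set_composition ?D D"
    using cF sub D unfolding set_composition_def by (auto intro: sorted_wrt_take sorted_wrt_drop)
  have mono: "r x < r y" if "x \<in> ?D" "y \<in> ?D" "\<bar>x\<bar> < \<bar>y\<bar>" for x y
    unfolding r_def
  proof (rule psubset_card_mono)
    show "finite {z \<in> ?D. \<bar>z\<bar> \<le> \<bar>y\<bar>}" by (rule finite_subset[OF _ fin]) blast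
    show "{z \<in> ?D. \<bar>z\<bar> \<le> \<bar>x\<bar>} \<subset> {z \<in> ?D. \<bar>z\<bar> \<le> \<bar>y\<bar>}"
    proof (rule psubsetI)
      show "{z \<in> ?D. \<bar>z\<bar> \<le> \<bar>x\<bar>} \<subseteq> {z \<in> ?D. \<bar>z\<bar> \<le> \<bar>y\<bar>}"
        using that(3) by (intro Collect_mono) (meson less_imp_le order_trans)
      have "y \<in> {z \<in> ?D. \<bar>z\<bar> \<le> \<bar>y\<bar>}" "y \<notin> {z \<in> ?D. \<bar>z\<bar> \<le> \<bar>x\<bar>}"
        using that by simp_all
      then show "{z \<in> ?D. \<bar>z\<bar> \<le> \<bar>x\<bar>} \<noteq> {z \<in> ?D. \<bar>z\<bar> \<le> \<bar>y\<bar>}" by metis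
    qed
  qed
  have injr: "inj_on r ?D"
  proof (rule inj_onI)
    fix x y assume xy: "x \<in> ?D" "y \<in> ?D" "r x = r y"
    then have "\<bar>x\<bar> = \<bar>y\<bar>" using mono[of x y] mono[of y x] by (cases rule: linorder_cases[of "\<bar>x\<bar>" "\<bar>y\<bar>"]) auto
    then show "x = y" using inj xy by (meson inj_onD)
  qed
  have pos: "r x > 0" if "x \<in> ?D" for x
  proof -
    have "finite {y \<in> ?D. \<bar>y\<bar> \<le> \<bar>x\<bar>}" by (rule finite_subset[OF _ fin]) blast
    moreover have "x \<in> {y \<in> ?D. \<bar>y\<bar> \<le> \<bar>x\<bar>}" using that by simp
    ultimately show ?thesis unfolding r_def card_gt_0_iff by blast
  qed
  have le: "r x \<le> card ?D" for x unfolding r_def by (rule card_mono[OF fin]) auto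
  have "r ` ?D \<subseteq> {1..card ?D}" using pos le by (force simp: Suc_le_eq)
  then have "r ` ?D = {1..card ?D}"
    using card_image[OF injr] by (intro card_subset_eq) auto
  then have "bij_betw r ?D {1..card ?D}" using injr by (simp add: bij_betw_def)
  moreover have "bij_betw int {1..card ?D} {1..int (card ?D)}"
    by (rule bij_betw_byWitness[where f' = nat]) auto
  ultimately have "bij_betw (int \<circ> r) ?D {1..int (card ?D)}" by (rule bij_betw_trans)
  then have b: "bij_betw (abs \<circ> f) ?D {1..int (card ?D)}"
    using nz by (subst bij_betw_cong[where g = "int \<circ> r"]) (auto simp: f_def abs_sgn_mult)
  then have i: "inj_on f ?D" by (meson bij_betw_def inj_on_imageI2)
  have "bij_betw abs (f ` ?D) {1..int (card ?D)}"
    using b by (simp add: bij_betw_def inj_on_imageI image_comp)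
  moreover have "set_composition (f ` ?D) (relabel f D)" by (rule set_composition_relabel[OF cD i])
  moreover have st: "standardize D = relabel f D" by (simp only: standardize_def f_def[abs_def] r_def)
  ultimately show "signed_composition (card ?D) (standardize D)"
    by (simp add: signed_composition_iff)
  show "inj_on (\<lambda>x. sgn x * int (card {y \<in> ?D. \<bar>y\<bar> \<le> \<bar>x\<bar>})) ?D"
    using i by (simp only: f_def[abs_def] r_def)
  show "sgn (sgn x * int (card {y \<in> ?D. \<bar>y\<bar> \<le> \<bar>x\<bar>})) = sgn x" if "x \<in> ?D" for x
    using pos[OF that] unfolding r_def sgn_mult by (simp only: sgn_pos of_nat_0_less_iff mult_1_right sgn_sgn)
qed

lemma same_orbit_standardize:
  assumes "signed_composition n F" "signed_composition n (relabel h F)"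
    and i: "inj_on h (\<Union>(set F))" and sg: "\<And>x. x \<in> \<Union>(set F) \<Longrightarrow> sgn (h x) = sgn x"
    and D: "D = take i F \<and> D' = take i (relabel h F) \<or> D = drop i F \<and> D' = drop i (relabel h F)"
  shows "same_orbit (standardize D) (standardize D')"
proof -
  let ?D = "\<Union>(set D)" and ?D' = "\<Union>(set D')"
  have D': "D' = relabel h D"
    using D by (auto simp: relabel_def take_map drop_map)
  have sub: "set D \<subseteq> set F" using D set_take_subset set_drop_subset by metis
  then have subU: "?D \<subseteq> \<Union>(set F)" by blast
  have U': "?D' = h ` ?D" by (simp add: D')
  have ih: "inj_on h ?D" using i subU by (rule inj_on_subset)
  have cc: "card ?D' = card ?D" using U' card_image[OF ih] by simp
  define f where "f x = sgn x * int (card {y \<in> ?D. \<bar>y\<bar> \<le> \<bar>x\<bar>})" for x :: int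
  define g where "g x = sgn x * int (card {y \<in> ?D'. \<bar>y\<bar> \<le> \<bar>x\<bar>})" for x :: int
  have f: "signed_composition (card ?D) (relabel f D)" "inj_on f ?D"
    "\<And>x. x \<in> ?D \<Longrightarrow> sgn (f x) = sgn x"
    using signed_composition_segment[OF assms(1), of D i] D
    by (auto simp: f_def[abs_def] standardize_def)
  have g: "signed_composition (card ?D) (relabel g D')" "inj_on g ?D'"
    "\<And>x. x \<in> ?D' \<Longrightarrow> sgn (g x) = sgn x"
    using signed_composition_segment[OF assms(2), of D' i] D cc
    by (auto simp: g_def[abs_def] standardize_def)
  define k where "k x = g (h (inv_into ?D f x))" for x
  have k: "k (f x) = g (h x)" if "x \<in> ?D" for x
    using that f(2) by (simp add: k_def)
  have e: "relabel k (relabel f D) = relabel g D'"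
    unfolding D' relabel_relabel using k by (rule relabel_cong)
  have "same_orbit (relabel f D) (relabel k (relabel f D))"
  proof (rule same_orbitI)
    show "signed_composition (card ?D) (relabel f D)" by (rule f)
    show "signed_composition (card ?D) (relabel k (relabel f D))" unfolding e by (rule g)
    have "inj_on (\<lambda>x. g (h x)) ?D"
      using comp_inj_on[OF ih, of g] g(2) U' by (simp add: comp_def)
    then show "inj_on k (\<Union>(set (relabel f D)))"
      unfolding Union_relabel
    proof (intro inj_onI)
      fix x y assume xy: "x \<in> f ` ?D" "y \<in> f ` ?D" "k x = k y"
      then obtain u v where uv: "u \<in> ?D" "v \<in> ?D" "x = f u" "y = f v" by blast
      then have "g (h u) = g (h v)" using xy k by simp
      then have "u = v" using \<open>inj_on (\<lambda>x. g (h x)) ?D\<close> uv(1,2) by (meson inj_onD)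
      then show "x = y" using uv by simp
    qed
    show "sgn (k x) = sgn x" if x: "x \<in> \<Union>(set (relabel f D))" for x
    proof -
      obtain y where y: "y \<in> ?D" "x = f y" using x unfolding Union_relabel by blast
      have "sgn (g (h y)) = sgn (h y)" using g(3) y(1) U' by blast
      also have "\<dots> = sgn y" using sg y(1) subU by blast
      finally show ?thesis using y k f(3) by simp
    qed
  qed
  then show ?thesis
    unfolding e by (simp add: standardize_def f_def[abs_def] g_def[abs_def])
qed

lemma ex_quasishuffle_relabel:
  assumes "same_orbit F F'" "same_orbit G G'"
  obtains n m k where "signed_composition n F" "signed_composition n F'"
    "signed_composition m G" "signed_composition m G'"
    "inj_on k (\<Union>(set F) \<union> \<Union>(set (relabel (signed_shift n) G)))"
    "\<And>x. x \<in> \<Union>(set F) \<union> \<Union>(set (relabel (signed_shift n) G)) \<Longrightarrow> sgn (k x) = sgn x"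
    "F' = relabel k F"
    "relabel (signed_shift n) G' = relabel k (relabel (signed_shift n) G)"
proof -
  from assms(1) obtain n h where F: "signed_composition n F" and F': "signed_composition n F'"
    and i: "inj_on h (\<Union>(set F))" and sg: "\<And>x. x \<in> \<Union>(set F) \<Longrightarrow> sgn (h x) = sgn x"
    and eF: "F' = relabel h F" unfolding same_orbit_iff by blast
  from assms(2) obtain m g where G: "signed_composition m G" and G': "signed_composition m G'"
    and i': "inj_on g (\<Union>(set G))" and sg': "\<And>x. x \<in> \<Union>(set G) \<Longrightarrow> sgn (g x) = sgn x"
    and eG: "G' = relabel g G" unfolding same_orbit_iff by blast
  let ?U = "\<Union>(set F)" and ?V = "\<Union>(set G)"
  let ?s = "signed_shift n"
  define k where "k x = (if x \<in> ?U then h x else ?s (g (inv ?s x)))" for x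
  have nzV: "x \<noteq> 0" if "x \<in> ?V" for x using signed_composition_range[OF G that] by auto
  have nzV': "g x \<noteq> 0" if "x \<in> ?V" for x using sg'[OF that] nzV[OF that] by (metis sgn_0_0)
  have nin: "?s x \<notin> ?U" if "x \<in> ?V" for x
  proof
    assume "?s x \<in> ?U"
    then have "\<bar>?s x\<bar> \<in> {1..int n}" by (rule signed_composition_range[OF F])
    then show False using signed_shift_props(1)[OF nzV[OF that], of n] nzV[OF that] by simp
  qed
  have kU: "k x = h x" if "x \<in> ?U" for x using that by (simp add: k_def)
  have kV: "k (?s x) = ?s (g x)" if "x \<in> ?V" for x
    using nin[OF that] inj_signed_shift by (simp add: k_def)
  have dis: "h x \<noteq> ?s (g y)" if "x \<in> ?U" "y \<in> ?V" for x y
  proof -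
    have "\<bar>h x\<bar> \<le> int n" using signed_composition_range[OF F', of "h x"] that eF by simp
    moreover have "\<bar>g y\<bar> \<ge> 1" using signed_composition_range[OF G', of "g y"] that eG by simp
    ultimately show ?thesis using signed_shift_props(1)[OF nzV'[OF that(2)], of n] by auto
  qed
  have "inj_on k ?U" using i kU by (simp add: inj_on_def)
  moreover have "inj_on k (?s ` ?V)"
  proof (rule inj_onI)
    fix x y assume xy: "x \<in> ?s ` ?V" "y \<in> ?s ` ?V" "k x = k y"
    then obtain u v where uv: "u \<in> ?V" "v \<in> ?V" "x = ?s u" "y = ?s v" by blast
    have "?s (g u) = ?s (g v)" using xy(3) kV[OF uv(1)] kV[OF uv(2)] uv by simp
    then have "u = v" using inj_signed_shift i' uv(1,2) by (meson injD inj_onD)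
    then show "x = y" using uv by simp
  qed
  moreover have "k ` ?U \<inter> k ` (?s ` ?V) = {}" using kU kV dis by fastforce
  ultimately have ik: "inj_on k (?U \<union> ?s ` ?V)"
    by (subst inj_on_Un) blast
  have sk: "sgn (k x) = sgn x" if x: "x \<in> ?U \<union> ?s ` ?V" for x
  proof (cases "x \<in> ?U")
    case True
    then show ?thesis using kU sg by simp
  next
    case False
    then obtain v where v: "v \<in> ?V" "x = ?s v" using x by blast
    then show ?thesis
      using kV signed_shift_props(2) nzV nzV' sg' by simp
  qed
  show ?thesis
  proof (rule that[of n m k])
    show "F' = relabel k F" unfolding eF using kU by (intro relabel_cong) simp
    show "relabel ?s G' = relabel k (relabel ?s G)"
      unfolding eG relabel_relabel using kV by (intro relabel_cong) simp
  qed (use F F' G G' ik sk in auto)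
qed


section \<open>The Hopf algebra of orbits of signed set compositions\<close>

quotient_type comp_orbit = "int set list" / partial: same_orbit
proof (rule part_equivpI)
  show "\<exists>F. same_orbit F F" using same_orbit_refl signed_composition_Nil by blast
  show "symp same_orbit" using same_orbit_sym by (rule sympI)
  show "transp same_orbit" using same_orbit_trans by (rule transpI)
qed

lift_definition orbit_degree :: "comp_orbit \<Rightarrow> nat" is "\<lambda>F. card (\<Union>(set F))"
  by (metis same_orbit_iff signed_composition_card)

lift_definition empty_orbit :: comp_orbit is "[]"
  using same_orbit_refl signed_composition_Nil by blast

lemma abs_comp_orbit_eq: "same_orbit F G \<Longrightarrow> abs_comp_orbit F = abs_comp_orbit G"
  using Quotient_rel_abs[OF Quotient_comp_orbit] .

lift_definition orbit_mult :: "comp_orbit \<Rightarrow> comp_orbit \<Rightarrow> (comp_orbit \<Rightarrow>\<^sub>0 'k::field)" is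
  "\<lambda>F G. \<Sum>H\<in>set_quasishuffles F (relabel (signed_shift (card (\<Union>(set F)))) G).
     bas (abs_comp_orbit H)"
proof -
  fix F F' G G' :: "int set list"
  assume "same_orbit F F'" "same_orbit G G'"
  then obtain n m k where F: "signed_composition n F" "signed_composition n F'"
    and G: "signed_composition m G" "signed_composition m G'"
    and i: "inj_on k (\<Union>(set F) \<union> \<Union>(set (relabel (signed_shift n) G)))"
    and sg: "\<And>x. x \<in> \<Union>(set F) \<union> \<Union>(set (relabel (signed_shift n) G)) \<Longrightarrow> sgn (k x) = sgn x"
    and F': "F' = relabel k F"
    and G': "relabel (signed_shift n) G' = relabel k (relabel (signed_shift n) G)"
    by (rule ex_quasishuffle_relabel) blast
  let ?G = "relabel (signed_shift n) G" and ?G' = "relabel (signed_shift n) G'"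
  let ?X = "\<Union>(set F) \<union> \<Union>(set ?G)"
  let ?j = "inv_into ?X k"
  have X': "\<Union>(set F') \<union> \<Union>(set ?G') = k ` ?X" unfolding F' G' Union_relabel image_Un ..
  have bF: "relabel ?j F' = F" unfolding F' by (rule relabel_inv_into[OF i]) blast
  have bG: "relabel ?j ?G' = ?G" unfolding G' by (rule relabel_inv_into[OF i]) blast
  have "(\<Sum>H\<in>set_quasishuffles F ?G. bas (abs_comp_orbit H) :: comp_orbit \<Rightarrow>\<^sub>0 'k) =
        (\<Sum>H\<in>set_quasishuffles F' ?G'. bas (abs_comp_orbit H))"
  proof (rule sum.reindex_bij_witness[where i = "relabel ?j" and j = "relabel k"])
    fix H assume H: "H \<in> set_quasishuffles F ?G"
    have U: "\<Union>(set H) = ?X" by (rule set_quasishuffles_Union[OF H])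
    show "relabel ?j (relabel k H) = H"
      unfolding relabel_relabel using i U by (intro relabel_ident) simp
    show kH: "relabel k H \<in> set_quasishuffles F' ?G'"
      unfolding F' G' by (rule set_quasishuffles_relabel[OF i H])
    have "same_orbit H (relabel k H)"
    proof (rule same_orbitI)
      show "signed_composition (n + m) H"
        by (rule signed_composition_quasishuffle[OF F(1) G(1) H])
      show "signed_composition (n + m) (relabel k H)"
        by (rule signed_composition_quasishuffle[OF F(2) G(2) kH])
    qed (use i sg U in auto)
    then show "bas (abs_comp_orbit (relabel k H)) = (bas (abs_comp_orbit H) :: comp_orbit \<Rightarrow>\<^sub>0 'k)"
      by (simp add: abs_comp_orbit_eq)
  next
    fix H assume H: "H \<in> set_quasishuffles F' ?G'"
    have U: "\<Union>(set H) = k ` ?X" using set_quasishuffles_Union[OF H] X' by simp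
    show "relabel k (relabel ?j H) = H"
      unfolding relabel_relabel using U by (intro relabel_ident f_inv_into_f) simp
    have "inj_on ?j (\<Union>(set F') \<union> \<Union>(set ?G'))" unfolding X' by (rule inj_on_inv_into) simp
    then show "relabel ?j H \<in> set_quasishuffles F ?G"
      using set_quasishuffles_relabel[OF _ H, of ?j] bF bG by simp
  qed
  then show "(\<Sum>H\<in>set_quasishuffles F (relabel (signed_shift (card (\<Union>(set F)))) G).
       bas (abs_comp_orbit H) :: comp_orbit \<Rightarrow>\<^sub>0 'k) =
     (\<Sum>H\<in>set_quasishuffles F' (relabel (signed_shift (card (\<Union>(set F')))) G').
       bas (abs_comp_orbit H))"
    using F by (simp add: signed_composition_card)
qed

lift_definition orbit_comult :: "comp_orbit \<Rightarrow> (comp_orbit \<times> comp_orbit \<Rightarrow>\<^sub>0 'k::field)" is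
  "\<lambda>F. \<Sum>i\<le>length F. bas (abs_comp_orbit (standardize (take i F)),
                           abs_comp_orbit (standardize (drop i F)))"
proof -
  fix F F' :: "int set list"
  assume "same_orbit F F'"
  then obtain n h where *: "signed_composition n F" "signed_composition n (relabel h F)"
    "inj_on h (\<Union>(set F))" "\<And>x. x \<in> \<Union>(set F) \<Longrightarrow> sgn (h x) = sgn x"
    and F': "F' = relabel h F" unfolding same_orbit_iff by blast
  have t: "abs_comp_orbit (standardize (take i F)) = abs_comp_orbit (standardize (take i F'))" for i
    unfolding F' by (intro abs_comp_orbit_eq same_orbit_standardize[OF *, where i = i]) auto
  have d: "abs_comp_orbit (standardize (drop i F)) = abs_comp_orbit (standardize (drop i F'))" for i
    unfolding F' by (intro abs_comp_orbit_eq same_orbit_standardize[OF *, where i = i]) auto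
  have "length F' = length F" by (simp add: F' relabel_def)
  then show "(\<Sum>i\<le>length F. bas (abs_comp_orbit (standardize (take i F)),
       abs_comp_orbit (standardize (drop i F))) :: comp_orbit \<times> comp_orbit \<Rightarrow>\<^sub>0 'k) =
     (\<Sum>i\<le>length F'. bas (abs_comp_orbit (standardize (take i F')),
       abs_comp_orbit (standardize (drop i F'))))"
    by (simp add: t d)
qed

definition DQLambda :: "(comp_orbit, 'k::field) hopf_data" where
  "DQLambda = \<lparr> hmult = bilin_ext orbit_mult,
                hunit = bas empty_orbit,
                hcomult = lin_ext orbit_comult,
                hcounit = (\<lambda>x. Poly_Mapping.lookup x empty_orbit) \<rparr>"


section \<open>The Hopf algebra of bicompositions\<close>

typedef column = "{c :: nat \<times> nat. c \<noteq> (0, 0)}"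
  by (rule exI[of _ "(1, 0)"]) simp

setup_lifting type_definition_column

instantiation column :: plus
begin

lift_definition plus_column :: "column \<Rightarrow> column \<Rightarrow> column" is
  "\<lambda>(a, b) (c, d). (a + c, b + d)"
  by auto

instance ..

end

lift_definition column_degree :: "column \<Rightarrow> nat" is "\<lambda>(a, b). a + b" .

type_synonym bicomposition = "column list"

definition bicomp_degree :: "bicomposition \<Rightarrow> nat" where
  "bicomp_degree c = sum_list (map column_degree c)"

text \<open>All quasishuffles, listed with multiplicity: the first column of a quasishuffle of two nonempty
  lists is the first column of the left one, the first column of the right one, or their sum.\<close>

fun quasishuffles :: "'a::plus list \<Rightarrow> 'a list \<Rightarrow> 'a list list" where
  "quasishuffles [] b = [b]"
| "quasishuffles (x # a) [] = [x # a]"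
| "quasishuffles (x # a) (y # b) =
     map ((#) x) (quasishuffles a (y # b)) @
     map ((#) y) (quasishuffles (x # a) b) @
     map ((#) (x + y)) (quasishuffles a b)"

definition DQSym :: "(bicomposition, 'k::field) hopf_data" where
  "DQSym = \<lparr> hmult = bilin_ext (\<lambda>a b. sum_list (map bas (quasishuffles a b))),
             hunit = bas [],
             hcomult = lin_ext (\<lambda>c. \<Sum>i\<le>length c. bas (take i c, drop i c)),
             hcounit = (\<lambda>x. Poly_Mapping.lookup x []) \<rparr>"

end

theory Submission
  imports Defs
begin

text \<open>
  The orbit of a set composition \<open>F\<^sub>1|\<dots>|F\<^sub>k\<close> is determined by the numbers of positive and of negative
  elements of each block, and these numbers form an arbitrary bicomposition. Merging two disjoint
  blocks adds their columns, and a quasishuffle of disjoint set compositions is determined by its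
  first block (the first block of either factor, or their union) together with a quasishuffle of
  what remains; so the products agree with multiplicities. Deconcatenation is visibly preserved.

  The Hopf algebra axioms are proved once, for quasishuffles of words over a semigroup \<open>A\<close>. With
  \<open>P\<^sub>x\<close> the operator that prepends the letter \<open>x\<close>, the structure is governed by
  \<open>P\<^sub>x u \<cdot> P\<^sub>y v = P\<^sub>x (u \<cdot> P\<^sub>y v) + P\<^sub>y (P\<^sub>x u \<cdot> v) + P\<^bsub>x+y\<^esub> (u \<cdot> v)\<close> and
  \<open>\<Delta> (P\<^sub>x u) = 1 \<otimes> P\<^sub>x u + (P\<^sub>x \<otimes> id) (\<Delta> u)\<close>, from which associativity and compatibility follow by
  induction. Both one-sided convolution inverses of the identity exist by recursion on the length.
\<close>

section \<open>Linear maps between free vector spaces\<close>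

lemma lookup_smult [simp]: "Poly_Mapping.lookup (smult c x) a = c * Poly_Mapping.lookup x a"
  by (simp add: smult_def Poly_Mapping.map.rep_eq when_def)

lemma lookup_bas: "Poly_Mapping.lookup (bas b) a = (if a = b then 1 else 0)"
  by (simp add: bas_def lookup_single when_def)

lemma vector_space_smult: "vector_space (smult :: 'k::field \<Rightarrow> ('b \<Rightarrow>\<^sub>0 'k) \<Rightarrow> _)"
  by unfold_locales (auto intro!: poly_mapping_eqI simp: lookup_add algebra_simps)

lemma vector_space_field: "vector_space ((*) :: 'k::field \<Rightarrow> 'k \<Rightarrow> 'k)"
  by unfold_locales (auto simp: algebra_simps)

interpretation free: vector_space "smult :: 'k::field \<Rightarrow> ('b \<Rightarrow>\<^sub>0 'k) \<Rightarrow> _"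
  by (rule vector_space_smult)

lemma is_linearI:
  assumes "\<And>x y. f (x + y) = f x + f y" "\<And>c x. f (smult c x) = smult c (f x)"
  shows "is_linear f"
  unfolding Vector_Spaces.linear_iff by (intro conjI vector_space_smult allI assms)

lemma functionalI:
  assumes "\<And>x y. f (x + y) = f x + f y" "\<And>c x. f (smult c x) = c * f x"
  shows "Vector_Spaces.linear smult (*) f"
  unfolding Vector_Spaces.linear_iff
  by (intro conjI vector_space_smult vector_space_field allI assms)

text \<open>A vector is the finite sum of its coefficients times basis vectors, so linearity expands
  \<open>f x\<close>. The scaling \<open>s\<close> of the target stays general in order to cover
  both maps into free spaces and functionals into the field.\<close>

lemma linear_lin_ext_eq:
  assumes "Vector_Spaces.linear smult s f"
  shows "f x = (\<Sum>a\<in>Poly_Mapping.keys x. s (Poly_Mapping.lookup x a) (f (bas a)))"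
proof -
  interpret Vector_Spaces.linear smult s f by (rule assms)
  have "x = (\<Sum>a\<in>Poly_Mapping.keys x. smult (Poly_Mapping.lookup x a) (bas a))"
    by (rule poly_mapping_eqI)
      (auto simp: lookup_sum lookup_bas in_keys_iff if_distrib cong: if_cong)
  then have "f x = f (\<Sum>a\<in>Poly_Mapping.keys x. smult (Poly_Mapping.lookup x a) (bas a))" by simp
  then show ?thesis by (simp add: sum scale)
qed

lemma linear_eqI:
  assumes "Vector_Spaces.linear smult s f" "Vector_Spaces.linear smult s g"
    "\<And>a. f (bas a) = g (bas a)"
  shows "f x = g x"
  using assms linear_lin_ext_eq[OF assms(1), of x] linear_lin_ext_eq[OF assms(2), of x] by simp

lemmas is_linear_eqI = linear_eqI[where s = smult]

lemma is_linear_add: "is_linear f \<Longrightarrow> f (x + y) = f x + f y"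
  by (simp add: Vector_Spaces.linear_iff)

lemma is_linear_smult: "is_linear f \<Longrightarrow> f (smult c x) = smult c (f x)"
  by (simp add: Vector_Spaces.linear_iff)

lemma is_linear_zero: "is_linear f \<Longrightarrow> f 0 = 0"
  using is_linear_smult[of f 0 0] by simp


lemma is_linear_sum: "is_linear f \<Longrightarrow> f (sum g I) = (\<Sum>i\<in>I. f (g i))"
  by (induction I rule: infinite_finite_induct) (auto simp: is_linear_zero is_linear_add)

lemma is_linear_sum_list: "is_linear f \<Longrightarrow> f (sum_list xs) = sum_list (map f xs)"
  by (induction xs) (auto simp: is_linear_zero is_linear_add)

section \<open>Linearity of composite expressions\<close>

named_theorems lin

lemma lin_ident [lin]: "is_linear (\<lambda>x. x)"
  by (rule is_linearI) auto

lemma lin_id [lin]: "is_linear id"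
  by (rule is_linearI) auto

lemma lin_plus [lin]: "is_linear f \<Longrightarrow> is_linear g \<Longrightarrow> is_linear (\<lambda>x. f x + g x)"
  by (rule is_linearI) (auto simp: is_linear_add is_linear_smult free.scale_right_distrib)

lemma lin_scale [lin]: "is_linear f \<Longrightarrow> is_linear (\<lambda>x. smult c (f x))"
  by (rule is_linearI)
    (auto simp: is_linear_add is_linear_smult free.scale_right_distrib mult.commute)

lemma lin_scale_functional [lin]:
  "Vector_Spaces.linear smult (*) f \<Longrightarrow> is_linear (\<lambda>x. smult (f x) v)"
  by (rule is_linearI) (auto simp: Vector_Spaces.linear_iff free.scale_left_distrib)

lemma lin_sum [lin]: "(\<And>i. is_linear (f i)) \<Longrightarrow> is_linear (\<lambda>x. \<Sum>i\<in>I. f i x)"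
  by (rule is_linearI)
    (auto simp: is_linear_add is_linear_smult free.scale_sum_right sum.distrib)

lemma lin_compose: "is_linear f \<Longrightarrow> is_linear g \<Longrightarrow> is_linear (\<lambda>x. f (g x))"
  by (rule is_linearI) (auto simp: is_linear_add is_linear_smult)

lemma functional_compose:
  "Vector_Spaces.linear smult (*) f \<Longrightarrow> is_linear g \<Longrightarrow> Vector_Spaces.linear smult (*) (\<lambda>x. f (g x))"
  by (rule functionalI) (auto simp: Vector_Spaces.linear_iff)

lemma functional_lookup: "Vector_Spaces.linear smult (*) (\<lambda>x. Poly_Mapping.lookup x a)"
  by (rule functionalI) (auto simp: lookup_add)

text \<open>Coefficients outside the support vanish. Enlarging the index set lets \<open>x\<close>,
  \<open>y\<close> and \<open>x + y\<close>, whose supports differ, be summed over a common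
  set.\<close>

lemma lin_ext_superset:
  assumes "finite K" "Poly_Mapping.keys x \<subseteq> K"
  shows "lin_ext f x = (\<Sum>a\<in>K. smult (Poly_Mapping.lookup x a) (f a))"
  unfolding lin_ext_def using assms
  by (intro sum.mono_neutral_left) (auto simp: in_keys_iff)

lemma linear_lin_ext:
  fixes f :: "'a \<Rightarrow> ('b \<Rightarrow>\<^sub>0 'k::field)"
  shows "is_linear (lin_ext f)"
proof (rule is_linearI)
  fix x y :: "'a \<Rightarrow>\<^sub>0 'k" and c
  let ?K = "Poly_Mapping.keys x \<union> Poly_Mapping.keys y"
  have "Poly_Mapping.keys (x + y) \<subseteq> ?K" by (rule Poly_Mapping.keys_add)
  then show "lin_ext f (x + y) = lin_ext f x + lin_ext f y"
    by (simp add: lin_ext_superset[of ?K] lookup_add free.scale_left_distrib sum.distrib)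
  have "Poly_Mapping.keys (smult c x) \<subseteq> Poly_Mapping.keys x"
    by (auto simp: in_keys_iff)
  then show "lin_ext f (smult c x) = smult c (lin_ext f x)"
    by (simp add: lin_ext_superset[of "Poly_Mapping.keys x"] free.scale_sum_right)
qed

lemma lin_ext_bas [simp]: "lin_ext f (bas a) = f a"
  by (simp add: lin_ext_def bas_def)

text \<open>The inner linear map \<open>g\<close> makes the rule applicable at any depth: repeated
  introduction descends through a nested expression until only the variable is left. The later rules
  in \<open>lin\<close> for products and tensors have the same form.\<close>

lemma lin_lin_ext [lin]: "is_linear g \<Longrightarrow> is_linear (\<lambda>x. lin_ext f (g x))"
  by (rule lin_compose[OF linear_lin_ext])


text \<open>Linearity here is in a parameter of the values on the basis, while the vector
  \<open>x\<close> is fixed. This is what makes \<open>bilin_ext\<close> linear in its second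
  argument.\<close>

lemma lin_ext_linear_fun [lin]:
  assumes "\<And>a. is_linear (f a)"
  shows "is_linear (\<lambda>y. lin_ext (\<lambda>a. f a y) x)"
  unfolding lin_ext_def by (intro lin assms)


lemma bilin_ext_bas [simp]: "bilin_ext f (bas a) (bas b) = f a b"
  by (simp add: bilin_ext_def)

lemma lin_bilin_ext_right [lin]: "is_linear g \<Longrightarrow> is_linear (\<lambda>y. bilin_ext f x (g y))"
  unfolding bilin_ext_def by (intro lin)

lemma lin_bilin_ext_left [lin]: "is_linear g \<Longrightarrow> is_linear (\<lambda>x. bilin_ext f (g x) y)"
  unfolding bilin_ext_def by (intro lin)

lemma linear_bilin_ext: "is_linear (bilin_ext f x)"
  by (rule lin_bilin_ext_right[OF lin_ident])

section \<open>Tensors of vectors, maps and products\<close>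

lemma lin_tensor_right [lin]: "is_linear g \<Longrightarrow> is_linear (\<lambda>y. tensor x (g y))"
  unfolding tensor_def by (intro lin)

lemma lin_tensor_left [lin]: "is_linear g \<Longrightarrow> is_linear (\<lambda>x. tensor (g x) y)"
  unfolding tensor_def by (intro lin)

lemma lin_tensor_map [lin]: "is_linear h \<Longrightarrow> is_linear (\<lambda>x. tensor_map f g (h x))"
  unfolding tensor_map_def by (intro lin)

lemma lin_tensor_assoc [lin]: "is_linear h \<Longrightarrow> is_linear (\<lambda>x. tensor_assoc (h x))"
  unfolding tensor_assoc_def by (intro lin)

lemma lin_mult_tensor [lin]: "is_linear h \<Longrightarrow> is_linear (\<lambda>x. mult_tensor A (h x))"
  unfolding mult_tensor_def by (intro lin)

lemma lin_tensor_mult_right [lin]: "is_linear g \<Longrightarrow> is_linear (\<lambda>y. tensor_mult A x (g y))"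
  unfolding tensor_mult_def by (intro lin)

lemma lin_tensor_mult_left [lin]: "is_linear g \<Longrightarrow> is_linear (\<lambda>x. tensor_mult A (g x) y)"
  unfolding tensor_mult_def by (intro lin)

lemma tensor_bas [simp]: "tensor (bas a) (bas b) = bas (a, b)"
  by (simp add: tensor_def)

lemma tensor_map_bas [simp]: "tensor_map f g (bas (a, b)) = tensor (f (bas a)) (g (bas b))"
  by (simp add: tensor_map_def)

lemma tensor_assoc_bas [simp]: "tensor_assoc (bas ((a, b), c)) = bas (a, b, c)"
  by (simp add: tensor_assoc_def)

lemma mult_tensor_bas [simp]: "mult_tensor A (bas (a, b)) = hmult A (bas a) (bas b)"
  by (simp add: mult_tensor_def)

lemma tensor_mult_bas [simp]:
  "tensor_mult A (bas (a, b)) (bas (c, d)) =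
     tensor (hmult A (bas a) (bas c)) (hmult A (bas b) (bas d))"
  by (simp add: tensor_mult_def)

lemma tensor_map_tensor:
  assumes "is_linear f" "is_linear g"
  shows "tensor_map f g (tensor x y) = tensor (f x) (g y)"
proof (rule is_linear_eqI[where f = "\<lambda>x. tensor_map f g (tensor x y)" and g = "\<lambda>x. tensor (f x) (g y)"])
  fix a
  show "tensor_map f g (tensor (bas a) y) = tensor (f (bas a)) (g y)"
    by (rule is_linear_eqI[where f = "\<lambda>y. tensor_map f g (tensor (bas a) y)"
          and g = "\<lambda>y. tensor (f (bas a)) (g y)"]) (intro lin assms | simp)+
qed (intro lin assms)+


lemma mult_tensor_tensor:
  assumes "\<And>x. is_linear (hmult A x)" "\<And>y. is_linear (\<lambda>x. hmult A x y)"
  shows "mult_tensor A (tensor x y) = hmult A x y"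
proof (rule is_linear_eqI[where f = "\<lambda>x. mult_tensor A (tensor x y)" and g = "\<lambda>x. hmult A x y"])
  fix a
  show "mult_tensor A (tensor (bas a) y) = hmult A (bas a) y"
    by (rule is_linear_eqI[where f = "\<lambda>y. mult_tensor A (tensor (bas a) y)"
          and g = "\<lambda>y. hmult A (bas a) y"]) (intro lin assms | simp)+
qed (intro lin assms)+

text \<open>Both sides are linear in each of the four arguments, so the formula that defines
  \<open>tensor_mult\<close> on basis pairs extends to arbitrary pure tensors. The inner fact treats
  \<open>z\<close> and \<open>w\<close> with the left tensor a basis element; \<open>x\<close> and
  \<open>y\<close> follow.\<close>

lemma tensor_mult_tensor:
  assumes "\<And>x. is_linear (hmult A x)" "\<And>y. is_linear (\<lambda>x. hmult A x y)"
  shows "tensor_mult A (tensor x y) (tensor z w) = tensor (hmult A x z) (hmult A y w)"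
proof -
  note L = lin lin_compose[OF assms(1)] lin_compose[OF assms(2)]
  have 1: "tensor_mult A (bas (a, b)) (tensor z w) = tensor (hmult A (bas a) z) (hmult A (bas b) w)"
    for a b
  proof (rule is_linear_eqI[where f = "\<lambda>z. tensor_mult A (bas (a, b)) (tensor z w)"
        and g = "\<lambda>z. tensor (hmult A (bas a) z) (hmult A (bas b) w)"])
    fix c
    show "tensor_mult A (bas (a, b)) (tensor (bas c) w) =
        tensor (hmult A (bas a) (bas c)) (hmult A (bas b) w)"
      by (rule is_linear_eqI[where f = "\<lambda>w. tensor_mult A (bas (a, b)) (tensor (bas c) w)"
            and g = "\<lambda>w. tensor (hmult A (bas a) (bas c)) (hmult A (bas b) w)"])
        (intro L | simp)+
  qed (intro L)+
  show ?thesis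
  proof (rule is_linear_eqI[where f = "\<lambda>x. tensor_mult A (tensor x y) (tensor z w)"
        and g = "\<lambda>x. tensor (hmult A x z) (hmult A y w)"])
    fix a
    show "tensor_mult A (tensor (bas a) y) (tensor z w) =
        tensor (hmult A (bas a) z) (hmult A y w)"
      by (rule is_linear_eqI[where f = "\<lambda>y. tensor_mult A (tensor (bas a) y) (tensor z w)"
            and g = "\<lambda>y. tensor (hmult A (bas a) z) (hmult A y w)"])
        (intro L | simp add: 1)+
  qed (intro L)+
qed

section \<open>Quasishuffle Hopf algebras\<close>

text \<open>The structure of \<open>DQSym\<close> with columns replaced by letters of an arbitrary
  type with addition.\<close>

definition quasishuffle_hopf :: "('a::plus list, 'k::field) hopf_data" where
  "quasishuffle_hopf =
     \<lparr> hmult = bilin_ext (\<lambda>a b. sum_list (map bas (quasishuffles a b))),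
       hunit = bas [],
       hcomult = lin_ext (\<lambda>c. \<Sum>i\<le>length c. bas (take i c, drop i c)),
       hcounit = (\<lambda>x. Poly_Mapping.lookup x []) \<rparr>"

definition qmul :: "('a::plus list \<Rightarrow>\<^sub>0 'k::field) \<Rightarrow> ('a list \<Rightarrow>\<^sub>0 'k) \<Rightarrow> ('a list \<Rightarrow>\<^sub>0 'k)" where
  "qmul = bilin_ext (\<lambda>a b. sum_list (map bas (quasishuffles a b)))"

definition deconc :: "('a list \<Rightarrow>\<^sub>0 'k::field) \<Rightarrow> ('a list \<times> 'a list \<Rightarrow>\<^sub>0 'k)" where
  "deconc = lin_ext (\<lambda>c. \<Sum>i\<le>length c. bas (take i c, drop i c))"

text \<open>The linear operator that prepends a letter; it turns recursions on words into identities
  between vectors.\<close>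

definition cons_map :: "'a \<Rightarrow> ('a list \<Rightarrow>\<^sub>0 'k::field) \<Rightarrow> ('a list \<Rightarrow>\<^sub>0 'k)" where
  "cons_map x = lin_ext (\<lambda>a. bas (x # a))"

lemma quasishuffle_hopf_sel [simp]:
  "hmult quasishuffle_hopf = qmul" "hunit quasishuffle_hopf = bas []"
  "hcomult quasishuffle_hopf = deconc"
  "hcounit quasishuffle_hopf = (\<lambda>x. Poly_Mapping.lookup x [])"
  by (simp_all add: quasishuffle_hopf_def qmul_def deconc_def)

lemma lin_qmul_right [lin]: "is_linear g \<Longrightarrow> is_linear (\<lambda>y. qmul x (g y))"
  unfolding qmul_def by (intro lin)

lemma lin_qmul_left [lin]: "is_linear g \<Longrightarrow> is_linear (\<lambda>x. qmul (g x) y)"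
  unfolding qmul_def by (intro lin)

lemma lin_deconc [lin]: "is_linear g \<Longrightarrow> is_linear (\<lambda>x. deconc (g x))"
  unfolding deconc_def by (intro lin)

lemma lin_cons_map [lin]: "is_linear g \<Longrightarrow> is_linear (\<lambda>u. cons_map x (g u))"
  unfolding cons_map_def by (intro lin)

lemma linear_qmul: "is_linear (qmul x)" "is_linear (\<lambda>x. qmul x y)"
  by (intro lin)+

lemma linear_cons_map: "is_linear (cons_map x)"
  by (intro lin)

lemma linear_deconc: "is_linear deconc"
  by (intro lin)

lemma cons_map_bas: "cons_map x (bas a) = bas (x # a)"
  by (simp add: cons_map_def)

lemma deconc_bas: "deconc (bas c) = (\<Sum>i\<le>length c. bas (take i c, drop i c))"
  by (simp add: deconc_def)

lemma cons_map_add: "cons_map x (u + v) = cons_map x u + cons_map x v"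
  by (simp add: is_linear_add linear_cons_map)

lemma qmul_add_left: "qmul (u + v) w = qmul u w + qmul v w"
  by (rule is_linear_add[OF linear_qmul(2)])

lemma qmul_add_right: "qmul w (u + v) = qmul w u + qmul w v"
  by (rule is_linear_add[OF linear_qmul(1)])

section \<open>Unit, recursion and associativity of the product\<close>

lemma qmul_Nil_left [simp]: "qmul (bas []) y = y"
  by (rule is_linear_eqI[where f = "qmul (bas [])" and g = "\<lambda>y. y"])
    (auto intro: lin simp: qmul_def)

lemma qmul_Nil_right [simp]: "qmul x (bas []) = x"
proof (rule is_linear_eqI[where f = "\<lambda>x. qmul x (bas [])" and g = "\<lambda>x. x"])
  show "qmul (bas a) (bas []) = bas a" for a :: "'a list" by (cases a) (simp_all add: qmul_def)
qed (intro lin)+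

text \<open>On basis words this is the third clause of \<open>quasishuffles\<close>, summed over the
  list; both sides are bilinear in \<open>u\<close> and \<open>v\<close>.\<close>

lemma qmul_cons_map:
  "qmul (cons_map x u) (cons_map y v) =
     cons_map x (qmul u (cons_map y v)) + cons_map y (qmul (cons_map x u) v) +
     cons_map (x + y) (qmul u v)"
proof -
  have bas: "qmul (cons_map x (bas a)) (cons_map y (bas b)) =
     cons_map x (qmul (bas a) (cons_map y (bas b))) + cons_map y (qmul (cons_map x (bas a)) (bas b)) +
     cons_map (x + y) (qmul (bas a) (bas b))" for a b
    by (simp add: cons_map_bas qmul_def)
      (simp add: is_linear_sum_list[OF linear_cons_map] cons_map_bas comp_def)
  show ?thesis
    by (rule is_linear_eqI[where x = u], (intro lin)+, rule is_linear_eqI[where x = v],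
        (intro lin)+, rule bas)
qed

text \<open>Induction on the total length of three words. If all are nonempty, the terms on either
  side are grouped by the nonempty set of first letters whose sum becomes the first letter of the
  result, and each group is an instance of the hypothesis. Associativity of addition identifies the
  two sums of all three letters.\<close>

lemma qmul_assoc:
  fixes u v w :: "'a::semigroup_add list \<Rightarrow>\<^sub>0 'k::field"
  shows "qmul (qmul u v) w = qmul u (qmul v w)"
proof -
  have bas: "qmul (qmul (bas a) (bas b)) (bas c) = (qmul (bas a) (qmul (bas b) (bas c)) :: 'a list \<Rightarrow>\<^sub>0 'k)"
    for a b c :: "'a list"
  proof (induction "length a + length b + length c" arbitrary: a b c rule: less_induct)
    case less
    show ?case
    proof (cases "a = [] \<or> b = [] \<or> c = []")
      case True
      then show ?thesis by auto
    next
      case False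
      then obtain x a' y b' z c' where e: "a = x # a'" "b = y # b'" "c = z # c'"
        by (meson neq_Nil_conv)
      \<comment> \<open>One instance for each nonempty subset of the first letters \<open>x\<close>,
        \<open>y\<close>, \<open>z\<close>, namely the letters that are removed.\<close>
      note IH = less[of a' b c] less[of a b' c] less[of a b c'] less[of a' b' c]
        less[of a' b c'] less[of a b' c'] less[of a' b' c']
      \<comment> \<open>The inner product of \<open>a\<close> and \<open>b\<close> is itself
        expanded by \<open>qmul_cons_map\<close>, so this instance is spread over three terms of the
        goal. With \<open>z\<close> already prepended, \<open>cons_map_add\<close> distributes it in
        the same way.\<close>
      from IH(3) have "cons_map z (qmul (qmul (bas a) (bas b)) (bas c')) =
          (cons_map z (qmul (bas a) (qmul (bas b) (bas c'))) :: 'a list \<Rightarrow>\<^sub>0 'k)"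
        by (simp add: e)
      then show ?thesis
        using IH unfolding e
        by (simp add: cons_map_bas[symmetric] qmul_cons_map cons_map_add qmul_add_left
            qmul_add_right add.assoc)
    qed
  qed
  show ?thesis
    by (rule is_linear_eqI[where x = u], (intro lin)+, rule is_linear_eqI[where x = v],
        (intro lin)+, rule is_linear_eqI[where x = w], (intro lin)+, rule bas)
qed

lemma quasishuffle_algebra:
  "is_algebra (quasishuffle_hopf :: ('a::semigroup_add list, 'k::field) hopf_data)"
  unfolding is_algebra_def by (auto simp: qmul_assoc intro: lin)

section \<open>Deconcatenation and its counit\<close>

lemma sum_nested_segments:
  fixes f :: "nat \<Rightarrow> nat \<Rightarrow> 'b::comm_monoid_add"
  shows "(\<Sum>i\<le>n. \<Sum>j\<le>n - i. f i (i + j)) = (\<Sum>k\<le>n. \<Sum>i\<le>k. f i k)"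
  unfolding sum.Sigma[OF finite_atMost ballI[OF finite_atMost]]
  \<comment> \<open>Both sums run over the pairs \<open>i \<le> k \<le> n\<close> with
    \<open>k = i + j\<close>, that is, over the ways to cut a word of length \<open>n\<close> into
    three segments; \<open>j\<close> is the length of the middle one.\<close>
  by (rule sum.reindex_bij_witness[where i = "\<lambda>(k, i). (i, k - i)" and j = "\<lambda>(i, j). (i + j, i)"])
    auto

lemma deconc_coassoc:
  "tensor_assoc (tensor_map deconc id (deconc x)) = tensor_map id deconc (deconc x)"
proof (rule is_linear_eqI[where x = x])
  fix c :: "'a list"
  \<comment> \<open>The cut of \<open>c\<close> at \<open>i\<close> and \<open>k\<close> into three
    segments; both iterated coproducts sum this over \<open>i \<le> k\<close>.\<close>
  let ?f = "\<lambda>i k. bas (take i c, drop i (take k c), drop k c)"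
  have "tensor_assoc (tensor_map deconc id (deconc (bas c))) = (\<Sum>k\<le>length c. \<Sum>i\<le>k. ?f i k)"
    by (auto simp: deconc_bas is_linear_sum[of tensor_assoc] is_linear_sum[of "tensor_map deconc id"]
        is_linear_sum[of "\<lambda>x. tensor x y" for y] lin intro!: sum.cong)
  also have "\<dots> = (\<Sum>i\<le>length c. \<Sum>j\<le>length c - i. ?f i (i + j))"
    by (rule sum_nested_segments[symmetric])
  also have "\<dots> = tensor_map id deconc (deconc (bas c))"
    by (auto simp: deconc_bas is_linear_sum[of "tensor_map id deconc"]
        is_linear_sum[of "tensor y" for y] lin drop_take add.commute intro!: sum.cong)
  finally show "tensor_assoc (tensor_map deconc id (deconc (bas c))) =
      tensor_map id deconc (deconc (bas c))" .
qed (intro lin)+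

text \<open>The counit vanishes on nonempty words, so of all cuts only the one at the beginning,
  respectively at the end, survives in the counit laws.\<close>

lemma quasishuffle_coalgebra:
  "is_coalgebra (quasishuffle_hopf :: ('a::plus list, 'k::field) hopf_data)"
proof -
  have l: "lin_ext (\<lambda>(a, b). smult (Poly_Mapping.lookup (bas a) []) (bas b)) (deconc x) = x"
    for x :: "'a list \<Rightarrow>\<^sub>0 'k"
  proof (rule is_linear_eqI[where x = x])
    fix c :: "'a list"
    have "lin_ext (\<lambda>(a, b). smult (Poly_Mapping.lookup (bas a) []) (bas b)) (deconc (bas c)) =
        (\<Sum>i\<le>length c. if i = 0 then bas c else (0 :: 'a list \<Rightarrow>\<^sub>0 'k))"
      unfolding deconc_bas is_linear_sum[OF linear_lin_ext]
      by (intro sum.cong) (auto simp: lookup_bas)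
    then show "lin_ext (\<lambda>(a, b). smult (Poly_Mapping.lookup (bas a) []) (bas b)) (deconc (bas c)) =
        (bas c :: 'a list \<Rightarrow>\<^sub>0 'k)"
      by simp
  qed (intro lin)+
  have r: "lin_ext (\<lambda>(a, b). smult (Poly_Mapping.lookup (bas b) []) (bas a)) (deconc x) = x"
    for x :: "'a list \<Rightarrow>\<^sub>0 'k"
  proof (rule is_linear_eqI[where x = x])
    fix c :: "'a list"
    have "lin_ext (\<lambda>(a, b). smult (Poly_Mapping.lookup (bas b) []) (bas a)) (deconc (bas c)) =
        (\<Sum>i\<le>length c. if i = length c then bas c else (0 :: 'a list \<Rightarrow>\<^sub>0 'k))"
      unfolding deconc_bas is_linear_sum[OF linear_lin_ext]
      by (intro sum.cong) (auto simp: lookup_bas)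
    then show "lin_ext (\<lambda>(a, b). smult (Poly_Mapping.lookup (bas b) []) (bas a)) (deconc (bas c)) =
        (bas c :: 'a list \<Rightarrow>\<^sub>0 'k)"
      by simp
  qed (intro lin)+
  show ?thesis
    unfolding is_coalgebra_def
    using l r by (auto simp: deconc_coassoc linear_deconc functional_lookup)
qed

text \<open>The cut in front of \<open>x\<close> gives the first summand; every other cut leaves
  \<open>x\<close> at the head of the left factor.\<close>

lemma deconc_cons_map:
  "deconc (cons_map x u) = tensor (bas []) (cons_map x u) + tensor_map (cons_map x) id (deconc u)"
proof (rule is_linear_eqI[where x = u])
  fix c :: "'a list"
  show "deconc (cons_map x (bas c)) =
      tensor (bas []) (cons_map x (bas c)) + tensor_map (cons_map x) id (deconc (bas c))"
    by (simp add: cons_map_bas deconc_bas is_linear_sum[of "tensor_map (cons_map x) id"] lin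
        sum.atMost_Suc_shift del: sum.atMost_Suc)
qed (intro lin)+

section \<open>Compatibility of product and coproduct\<close>

abbreviation (input) tmul ::
  "('a::plus list \<times> 'a list \<Rightarrow>\<^sub>0 'k::field) \<Rightarrow> ('a list \<times> 'a list \<Rightarrow>\<^sub>0 'k) \<Rightarrow> _" where
  "tmul \<equiv> tensor_mult quasishuffle_hopf"

lemma tmul_tensor: "tmul (tensor x y) (tensor z w) = tensor (qmul x z) (qmul y w)"
  by (simp add: tensor_mult_tensor linear_qmul)

lemma tmul_add_left: "tmul (u + v) w = tmul u w + tmul v w"
  by (rule is_linear_add[of "\<lambda>u. tmul u w"]) (intro lin)

lemma tmul_add_right: "tmul w (u + v) = tmul w u + tmul w v"
  by (rule is_linear_add[of "tmul w"]) (intro lin)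

lemma tensor_map_cons_map_tensor:
  "tensor_map (cons_map x) id (tensor u v) = tensor (cons_map x u) v"
  by (simp add: tensor_map_tensor lin)

text \<open>The other factor has the empty word in its left component, which is neutral there, so
  \<open>x\<close> remains the first letter. The next lemma is the mirror image.\<close>

lemma tmul_cons_map_left:
  "tmul (tensor_map (cons_map x) id U) (tensor (bas []) v) =
     tensor_map (cons_map x) id (tmul U (tensor (bas []) v))"
proof (rule is_linear_eqI[where x = U])
  fix p :: "'a list \<times> 'a list"
  show "tmul (tensor_map (cons_map x) id (bas p)) (tensor (bas []) v) =
      tensor_map (cons_map x) id (tmul (bas p) (tensor (bas []) v))"
    by (cases p) (simp add: tensor_bas[symmetric] tensor_map_cons_map_tensor tmul_tensor del: tensor_bas)
qed (intro lin)+

lemma tmul_cons_map_right: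
  "tmul (tensor (bas []) v) (tensor_map (cons_map x) id U) =
     tensor_map (cons_map x) id (tmul (tensor (bas []) v) U)"
proof (rule is_linear_eqI[where x = U])
  fix p :: "'a list \<times> 'a list"
  show "tmul (tensor (bas []) v) (tensor_map (cons_map x) id (bas p)) =
      tensor_map (cons_map x) id (tmul (tensor (bas []) v) (bas p))"
    by (cases p) (simp add: tensor_bas[symmetric] tensor_map_cons_map_tensor tmul_tensor del: tensor_bas)
qed (intro lin)+

text \<open>The recursion \<open>qmul_cons_map\<close> acting in the left component, extended from
  pairs of words to the whole tensor square.\<close>

lemma tmul_cons_map:
  "tmul (tensor_map (cons_map x) id U) (tensor_map (cons_map y) id V) =
     tensor_map (cons_map x) id (tmul U (tensor_map (cons_map y) id V)) +
     tensor_map (cons_map y) id (tmul (tensor_map (cons_map x) id U) V) +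
     tensor_map (cons_map (x + y)) id (tmul U V)"
proof -
  have add: "tensor (u + v) w = tensor u w + tensor v w"
    for u v w :: "'a list \<Rightarrow>\<^sub>0 'b"
    by (rule is_linear_add[of "\<lambda>u. tensor u w"]) (intro lin)
  have bas: "tmul (tensor_map (cons_map x) id (bas p)) (tensor_map (cons_map y) id (bas q)) =
     tensor_map (cons_map x) id (tmul (bas p) (tensor_map (cons_map y) id (bas q))) +
     tensor_map (cons_map y) id (tmul (tensor_map (cons_map x) id (bas p)) (bas q)) +
     (tensor_map (cons_map (x + y)) id (tmul (bas p) (bas q)) :: 'a list \<times> 'a list \<Rightarrow>\<^sub>0 'b)"
    for p q :: "'a list \<times> 'a list"
    by (cases p; cases q)
      (simp add: tensor_bas[symmetric] tensor_map_cons_map_tensor tmul_tensor qmul_cons_map add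
        del: tensor_bas tensor_mult_bas tensor_map_bas)
  show ?thesis
    by (rule is_linear_eqI[where x = U], (intro lin)+, rule is_linear_eqI[where x = V],
        (intro lin)+, rule bas)
qed

text \<open>Induction along the recursion of \<open>quasishuffles\<close>. For words with first
  letters \<open>x\<close> and \<open>y\<close>, both sides have the same part with empty left
  factor; the remaining terms begin on the left with \<open>x\<close>, \<open>y\<close> or
  \<open>x + y\<close>, and for each of these three the hypothesis applies behind the
  letter.\<close>

lemma deconc_qmul: "deconc (qmul u v) = tmul (deconc u) (deconc v)"
proof -
  have tadd: "tensor w (u + v) = tensor w u + tensor w v" for u v w :: "'a list \<Rightarrow>\<^sub>0 'b"
    by (rule is_linear_add[of "tensor w"]) (intro lin)
  have dadd: "deconc (u + v) = deconc u + deconc v" for u v :: "'a list \<Rightarrow>\<^sub>0 'b"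
    by (rule is_linear_add[OF linear_deconc])
  have madd: "tensor_map (cons_map x) id (U + V) =
      tensor_map (cons_map x) id U + tensor_map (cons_map x) id V"
    for x and U V :: "'a list \<times> 'a list \<Rightarrow>\<^sub>0 'b"
    by (rule is_linear_add[of "tensor_map (cons_map x) id"]) (intro lin)
  have unit: "deconc (bas []) = tensor (bas []) (bas [] :: 'a list \<Rightarrow>\<^sub>0 'b)"
    by (simp add: deconc_bas)
  have unit_left: "tmul (tensor (bas []) (bas [])) U = U" 
    for U :: "'a list \<times> 'a list \<Rightarrow>\<^sub>0 'b"
    by (rule is_linear_eqI[where g = "\<lambda>U. U" and x = U])
      (auto simp: tensor_bas[symmetric] tmul_tensor simp del: tensor_bas intro!: lin)
  have unit_right: "tmul U (tensor (bas []) (bas [])) = U" 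
    for U :: "'a list \<times> 'a list \<Rightarrow>\<^sub>0 'b"
    by (rule is_linear_eqI[where g = "\<lambda>U. U" and x = U])
      (auto simp: tensor_bas[symmetric] tmul_tensor simp del: tensor_bas intro!: lin)
  have bas: "deconc (qmul (bas a) (bas b)) =
      (tmul (deconc (bas a)) (deconc (bas b)) :: 'a list \<times> 'a list \<Rightarrow>\<^sub>0 'b)" for a b :: "'a list"
  proof (induction a b rule: quasishuffles.induct)
    case (3 x a y b)
    show ?case
      using 3
      unfolding cons_map_bas[symmetric] qmul_cons_map deconc_cons_map dadd tadd madd
        tmul_add_left tmul_add_right tmul_cons_map tmul_cons_map_left tmul_cons_map_right
        tmul_tensor qmul_Nil_left
      by (simp add: madd algebra_simps del: tensor_bas)
  qed (simp_all add: unit unit_left unit_right del: tensor_bas)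
  show ?thesis
    by (rule is_linear_eqI[where x = u], (intro lin)+, rule is_linear_eqI[where x = v],
        (intro lin)+, rule bas)
qed

text \<open>If both words are nonempty, each term of their product begins with a letter, so the
  coefficient of the empty word is zero on both sides.\<close>

lemma counit_qmul:
  fixes u v :: "'a::plus list \<Rightarrow>\<^sub>0 'b::field"
  shows "Poly_Mapping.lookup (qmul u v) [] = Poly_Mapping.lookup u [] * Poly_Mapping.lookup v []"
proof -
  have cons: "Poly_Mapping.lookup (cons_map x w) [] = 0" for x :: 'a and w :: "'a list \<Rightarrow>\<^sub>0 'b"
    by (rule linear_eqI[where g = "\<lambda>_. 0" and x = w])
      (auto intro!: functional_compose[OF functional_lookup] lin functionalI
        simp: cons_map_bas lookup_bas)
  have bas: "Poly_Mapping.lookup (qmul (bas a) (bas b)) [] =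
      Poly_Mapping.lookup (bas a :: _ \<Rightarrow>\<^sub>0 'b) [] * Poly_Mapping.lookup (bas b) []" for a b :: "'a list"
  proof (cases "a = [] \<or> b = []")
    case True
    then show ?thesis by (auto simp: lookup_bas)
  next
    case False
    then obtain x a' y b' where "a = x # a'" "b = y # b'" by (meson neq_Nil_conv)
    then show ?thesis
      by (simp add: cons_map_bas[symmetric] qmul_cons_map lookup_add cons)
  qed
  have r: "Vector_Spaces.linear smult (*) (\<lambda>v. c * Poly_Mapping.lookup v [])"
    and l: "Vector_Spaces.linear smult (*) (\<lambda>v. Poly_Mapping.lookup v [] * c)"
    for c :: 'b
    by (rule functionalI; simp add: lookup_add algebra_simps)+
  show ?thesis
    by (rule linear_eqI[where x = u], rule functional_compose[OF functional_lookup], intro lin,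
        rule l, rule linear_eqI[where x = v],
        rule functional_compose[OF functional_lookup], intro lin, rule r, rule bas)
qed

lemma quasishuffle_bialgebra:
  "is_bialgebra (quasishuffle_hopf :: ('a::semigroup_add list, 'k::field) hopf_data)"
  unfolding is_bialgebra_def
  by (simp add: quasishuffle_algebra quasishuffle_coalgebra deconc_qmul counit_qmul deconc_bas
      lookup_bas)

section \<open>The antipode\<close>

function antipode_left :: "'a::plus list \<Rightarrow> ('a list \<Rightarrow>\<^sub>0 'k::field)" where
  "antipode_left c = (if c = [] then bas [] else
     - (\<Sum>i<length c. qmul (antipode_left (take i c)) (bas (drop i c))))"
  by auto
termination by (relation "measure length") auto

function antipode_right :: "'a::plus list \<Rightarrow> ('a list \<Rightarrow>\<^sub>0 'k::field)" where
  "antipode_right c = (if c = [] then bas [] else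
     - (\<Sum>i\<in>{0<..length c}. qmul (bas (take i c)) (antipode_right (drop i c))))"
  by auto
termination by (relation "measure length") auto

declare antipode_left.simps [simp del] antipode_right.simps [simp del]

text \<open>This says that \<open>antipode_left\<close> is a left convolution inverse of the
  identity. Its recursion is this equation solved for the term \<open>i = length c\<close>, whose
  second factor is the empty word; the other terms involve proper prefixes only.\<close>

lemma antipode_left_sum:
  "(\<Sum>i\<le>length c. qmul (antipode_left (take i c)) (bas (drop i c))) = (if c = [] then bas [] else 0)"
  using antipode_left.simps[of c] by (auto simp: lessThan_Suc_atMost[symmetric] antipode_left.simps)

text \<open>The mirror image, for a right convolution inverse: here the recursion isolates the term
  \<open>i = 0\<close>, so the sum in it starts at 1 and includes \<open>length c\<close>.\<close>

lemma antipode_right_sum: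
  "(\<Sum>i\<le>length c. qmul (bas (take i c)) (antipode_right (drop i c))) = (if c = [] then bas [] else 0)"
proof -
  have "{..length c} = insert 0 {0<..length c}" by auto
  then show ?thesis using antipode_right.simps[of c] by (auto simp: antipode_right.simps)
qed

text \<open>The left and the right convolution inverse of the identity agree, by associativity of
  convolution.\<close>

lemma antipode_left_eq_right:
  "antipode_left c = (antipode_right c :: 'a::semigroup_add list \<Rightarrow>\<^sub>0 'k::field)"
proof -
  let ?L = "antipode_left :: 'a list \<Rightarrow> 'a list \<Rightarrow>\<^sub>0 'k"
  let ?R = "antipode_right :: 'a list \<Rightarrow> 'a list \<Rightarrow>\<^sub>0 'k"
  let ?n = "length c"
  \<comment> \<open>The terms of the triple convolution of \<open>?L\<close>, the identity and
    \<open>?R\<close>. Summing over \<open>k\<close> first collapses it to \<open>?L c\<close>,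
    summing over \<open>i\<close> first to \<open>?R c\<close>.\<close>
  let ?f = "\<lambda>i k. qmul (?L (take i c)) (qmul (bas (drop i (take k c))) (?R (drop k c)))"
  have "?L c = (\<Sum>i\<le>?n. if i = ?n then ?L c else 0)" by simp
  also have "\<dots> = (\<Sum>i\<le>?n. qmul (?L (take i c)) (if drop i c = [] then bas [] else 0))"
    by (intro sum.cong) (auto simp: is_linear_zero linear_qmul)
  also have "\<dots> = (\<Sum>i\<le>?n. \<Sum>j\<le>?n - i. ?f i (i + j))"
    unfolding antipode_right_sum[symmetric] is_linear_sum[OF linear_qmul(1)]
    by (intro sum.cong) (auto simp: drop_take add.commute)
  also have "\<dots> = (\<Sum>k\<le>?n. \<Sum>i\<le>k. ?f i k)" by (rule sum_nested_segments)
  also have "\<dots> = (\<Sum>k\<le>?n. qmul (if take k c = [] then bas [] else 0) (?R (drop k c)))"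
    unfolding antipode_left_sum[symmetric] is_linear_sum[OF linear_qmul(2)] qmul_assoc
    by (intro sum.cong) auto
  also have "\<dots> = (\<Sum>k\<le>?n. if k = 0 then ?R c else 0)"
    by (intro sum.cong) (auto simp: is_linear_zero[OF linear_qmul(2)])
  also have "\<dots> = ?R c" by simp
  finally show ?thesis .
qed

lemma is_antipode_quasishuffle:
  "is_antipode (quasishuffle_hopf :: ('a::semigroup_add list, 'k::field) hopf_data)
     (lin_ext antipode_left)"
proof -
  let ?A = "quasishuffle_hopf :: ('a list, 'k) hopf_data"
  let ?S = "lin_ext antipode_left :: ('a list \<Rightarrow>\<^sub>0 'k) \<Rightarrow> _"
  have "mult_tensor ?A (tensor_map ?S id (deconc x)) = smult (Poly_Mapping.lookup x []) (bas [])" for x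
  proof (rule is_linear_eqI[where x = x])
    fix c :: "'a list"
    have "mult_tensor ?A (tensor_map ?S id (deconc (bas c))) =
        (\<Sum>i\<le>length c. qmul (antipode_left (take i c)) (bas (drop i c)))"
      by (simp add: deconc_bas is_linear_sum[of "tensor_map ?S id"] is_linear_sum[of "mult_tensor ?A"]
          lin mult_tensor_tensor)
    then show "mult_tensor ?A (tensor_map ?S id (deconc (bas c))) =
        smult (Poly_Mapping.lookup (bas c) []) (bas [])"
      by (simp add: antipode_left_sum lookup_bas)
  qed (intro lin functional_lookup)+
  moreover have "mult_tensor ?A (tensor_map id ?S (deconc x)) =
      smult (Poly_Mapping.lookup x []) (bas [])" for x
  proof (rule is_linear_eqI[where x = x])
    fix c :: "'a list"
    have "mult_tensor ?A (tensor_map id ?S (deconc (bas c))) =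
        (\<Sum>i\<le>length c. qmul (bas (take i c)) (antipode_left (drop i c)))"
      by (simp add: deconc_bas is_linear_sum[of "tensor_map id ?S"] is_linear_sum[of "mult_tensor ?A"]
          lin mult_tensor_tensor)
    then show "mult_tensor ?A (tensor_map id ?S (deconc (bas c))) =
        smult (Poly_Mapping.lookup (bas c) []) (bas [])"
      by (simp add: antipode_right_sum antipode_left_eq_right lookup_bas)
  qed (intro lin functional_lookup)+
  ultimately show ?thesis
    unfolding is_antipode_def by (simp add: linear_lin_ext)
qed

theorem quasishuffle_is_hopf_algebra:
  "is_hopf_algebra (quasishuffle_hopf :: ('a::semigroup_add list, 'k::field) hopf_data)"
  unfolding is_hopf_algebra_def using quasishuffle_bialgebra is_antipode_quasishuffle by blast

section \<open>Transport along a bijection of bases\<close>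

definition rename :: "('a \<Rightarrow> 'b) \<Rightarrow> ('a \<Rightarrow>\<^sub>0 'k::field) \<Rightarrow> ('b \<Rightarrow>\<^sub>0 'k)" where
  "rename \<tau> = lin_ext (\<lambda>a. bas (\<tau> a))"

lemma lin_rename [lin]: "is_linear g \<Longrightarrow> is_linear (\<lambda>x. rename \<tau> (g x))"
  unfolding rename_def by (intro lin)

lemma linear_rename: "is_linear (rename \<tau>)"
  by (intro lin)

lemma rename_bas [simp]: "rename \<tau> (bas a) = bas (\<tau> a)"
  by (simp add: rename_def)

lemma rename_rename: "rename \<sigma> (rename \<tau> x) = rename (\<lambda>a. \<sigma> (\<tau> a)) x"
  by (rule is_linear_eqI[where x = x]) (intro lin | simp)+

lemma rename_ident: "rename (\<lambda>a. a) x = x"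
  by (rule is_linear_eqI[where x = x]) (intro lin | simp)+

lemma rename_inverse:
  assumes "\<And>a. \<sigma> (\<tau> a) = a"
  shows "rename \<sigma> (rename \<tau> x) = x"
  by (simp add: rename_rename assms rename_ident)

lemma lookup_rename:
  assumes "inj \<tau>"
  shows "Poly_Mapping.lookup (rename \<tau> x) (\<tau> a) = Poly_Mapping.lookup x a"
  by (rule linear_eqI[where x = x])
    (auto intro!: functional_compose[OF functional_lookup] functional_lookup lin
      simp: lookup_bas inj_eq[OF assms])

lemma rename_tensor: "rename (map_prod \<sigma> \<tau>) (tensor x y) = tensor (rename \<sigma> x) (rename \<tau> y)"
  by (rule is_linear_eqI[where x = x], (intro lin)+, rule is_linear_eqI[where x = y],
      (intro lin)+, simp)

lemma tensor_map_rename: "tensor_map (rename \<sigma>) (rename \<tau>) x = rename (map_prod \<sigma> \<tau>) x"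
  by (rule is_linear_eqI[where x = x]) (auto intro!: lin)

text \<open>Transport of structure: \<open>B\<close> is a Hopf algebra, while \<open>A\<close> is
  only assumed to have linear operations that match those of \<open>B\<close> on basis vectors. The
  axioms for \<open>A\<close> are deduced from those for \<open>B\<close>.\<close>

locale basis_bijection =
  fixes \<tau> :: "'a \<Rightarrow> 'b" and \<sigma> :: "'b \<Rightarrow> 'a"
    and A :: "('a, 'k::field) hopf_data" and B :: "('b, 'k) hopf_data"
  assumes \<sigma>\<tau> [simp]: "\<sigma> (\<tau> a) = a" and \<tau>\<sigma> [simp]: "\<tau> (\<sigma> b) = b"
    and hopf: "is_hopf_algebra B"
    and lin_mult: "\<And>x. is_linear (hmult A x)" "\<And>y. is_linear (\<lambda>x. hmult A x y)"
    and lin_comult: "is_linear (hcomult A)"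
    and lin_counit: "Vector_Spaces.linear smult (*) (hcounit A)"
    and mult_bas: "\<And>a b. rename \<tau> (hmult A (bas a) (bas b)) = hmult B (bas (\<tau> a)) (bas (\<tau> b))"
    and unit: "rename \<tau> (hunit A) = hunit B"
    and comult_bas: "\<And>a. rename (map_prod \<tau> \<tau>) (hcomult A (bas a)) = hcomult B (bas (\<tau> a))"
    and counit_bas: "\<And>a. hcounit A (bas a) = hcounit B (bas (\<tau> a))"
begin

section \<open>Transfer of the Hopf algebra axioms from \<open>B\<close> to \<open>A\<close>\<close>

abbreviation "\<phi> \<equiv> rename \<tau> :: ('a \<Rightarrow>\<^sub>0 'k) \<Rightarrow> _"
abbreviation "\<psi> \<equiv> rename \<sigma> :: ('b \<Rightarrow>\<^sub>0 'k) \<Rightarrow> _"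
abbreviation "\<phi>2 \<equiv> rename (map_prod \<tau> \<tau>) :: ('a \<times> 'a \<Rightarrow>\<^sub>0 'k) \<Rightarrow> _"

lemma \<psi>\<phi> [simp]: "\<psi> (\<phi> x) = x"
  by (simp add: rename_inverse)

lemma \<phi>\<psi> [simp]: "\<phi> (\<psi> x) = x"
  by (simp add: rename_inverse)

lemma \<phi>_inject:
  assumes "\<phi> x = \<phi> y"
  shows "x = y"
  using arg_cong[OF assms, of \<psi>] by simp

lemma \<phi>2_inject:
  assumes "\<phi>2 x = \<phi>2 y"
  shows "x = y"
  using arg_cong[OF assms, of "rename (map_prod \<sigma> \<sigma>)"]
  by (simp add: rename_inverse[of "map_prod \<sigma> \<sigma>"] split_paired_all)

lemma bialgebra_B: "is_algebra B" "is_coalgebra B" "is_bialgebra B"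
  using hopf by (auto simp: is_hopf_algebra_def is_bialgebra_def)

lemma lin_multB: "is_linear (hmult B x)" "is_linear (\<lambda>x. hmult B x y)"
  and lin_comultB: "is_linear (hcomult B)"
  and lin_counitB: "Vector_Spaces.linear smult (*) (hcounit B)"
  using bialgebra_B by (auto simp: is_algebra_def is_coalgebra_def)

lemmas lin_ops = lin lin_compose[OF lin_mult(1)] lin_compose[OF lin_mult(2)]
  lin_compose[OF lin_multB(1)] lin_compose[OF lin_multB(2)]
  lin_compose[OF lin_comult] lin_compose[OF lin_comultB]

lemma mult: "\<phi> (hmult A x y) = hmult B (\<phi> x) (\<phi> y)"
  by (rule is_linear_eqI[where x = x], (intro lin_ops)+, rule is_linear_eqI[where x = y],
      (intro lin_ops)+, simp add: mult_bas)

lemma comult: "\<phi>2 (hcomult A x) = hcomult B (\<phi> x)"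
  by (rule is_linear_eqI[where x = x], (intro lin_ops)+, simp add: comult_bas)

lemma counit: "hcounit A x = hcounit B (\<phi> x)"
  by (rule linear_eqI[where x = x])
    (auto intro: lin_counit functional_compose[OF lin_counitB] linear_rename simp: counit_bas)

lemma algebra_A: "is_algebra A"
proof -
  have "hmult A (hmult A x y) z = hmult A x (hmult A y z)" for x y z
    using bialgebra_B(1) by (intro \<phi>_inject) (simp add: mult is_algebra_def)
  moreover have "hmult A (hunit A) x = x" "hmult A x (hunit A) = x" for x
    using bialgebra_B(1) by (auto intro!: \<phi>_inject simp: mult unit is_algebra_def)
  ultimately show ?thesis using lin_mult by (simp add: is_algebra_def)
qed

lemma \<phi>2_tensor_map:
  assumes "\<And>x. \<phi> (f x) = f' (\<phi> x)" "\<And>x. \<phi> (g x) = g' (\<phi> x)"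
  shows "\<phi>2 (tensor_map f g x) = tensor_map f' g' (\<phi>2 x)"
  by (rule is_linear_eqI[where x = x], (intro lin)+, auto simp: rename_tensor assms)

lemma coalgebra_A: "is_coalgebra A"
proof -
  let ?\<phi>3 = "rename (map_prod \<tau> (map_prod \<tau> \<tau>)) :: ('a \<times> 'a \<times> 'a \<Rightarrow>\<^sub>0 'k) \<Rightarrow> _"
  have l: "?\<phi>3 (tensor_assoc x) = tensor_assoc (rename (map_prod (map_prod \<tau> \<tau>) \<tau>) x)" for x
    by (rule is_linear_eqI[where x = x], (intro lin)+, auto)
  have m: "rename (map_prod (map_prod \<tau> \<tau>) \<tau>) (tensor_map (hcomult A) id x) =
      tensor_map (hcomult B) id (\<phi>2 x)" for x
    by (rule is_linear_eqI[where x = x], (intro lin)+, auto simp: rename_tensor comult)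
  have r: "?\<phi>3 (tensor_map id (hcomult A) x) = tensor_map id (hcomult B) (\<phi>2 x)" for x
    by (rule is_linear_eqI[where x = x], (intro lin)+, auto simp: rename_tensor comult)
  have inj: "x = y" if "?\<phi>3 x = ?\<phi>3 y" for x y
    using arg_cong[OF that, of "rename (map_prod \<sigma> (map_prod \<sigma> \<sigma>))"]
    by (simp add: rename_inverse[of "map_prod \<sigma> (map_prod \<sigma> \<sigma>)"] split_paired_all)
  have "tensor_assoc (tensor_map (hcomult A) id (hcomult A x)) =
      tensor_map id (hcomult A) (hcomult A x)" for x
    using bialgebra_B(2) by (intro inj) (simp add: l m r comult is_coalgebra_def)
  moreover have "lin_ext (\<lambda>(a, b). smult (hcounit A (bas a)) (bas b)) (hcomult A x) = x" for x
  proof (rule \<phi>_inject)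
    have "\<phi> (lin_ext (\<lambda>(a, b). smult (hcounit A (bas a)) (bas b)) y) =
        lin_ext (\<lambda>(a, b). smult (hcounit B (bas a)) (bas b)) (\<phi>2 y)" for y
      by (rule is_linear_eqI[where x = y], (intro lin)+,
          auto simp: is_linear_smult[OF linear_rename] counit)
    then show "\<phi> (lin_ext (\<lambda>(a, b). smult (hcounit A (bas a)) (bas b)) (hcomult A x)) = \<phi> x"
      using bialgebra_B(2) by (simp add: comult is_coalgebra_def)
  qed
  moreover have "lin_ext (\<lambda>(a, b). smult (hcounit A (bas b)) (bas a)) (hcomult A x) = x" for x
  proof (rule \<phi>_inject)
    have "\<phi> (lin_ext (\<lambda>(a, b). smult (hcounit A (bas b)) (bas a)) y) =
        lin_ext (\<lambda>(a, b). smult (hcounit B (bas b)) (bas a)) (\<phi>2 y)" for y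
      by (rule is_linear_eqI[where x = y], (intro lin)+,
          auto simp: is_linear_smult[OF linear_rename] counit)
    then show "\<phi> (lin_ext (\<lambda>(a, b). smult (hcounit A (bas b)) (bas a)) (hcomult A x)) = \<phi> x"
      using bialgebra_B(2) by (simp add: comult is_coalgebra_def)
  qed
  ultimately show ?thesis using lin_comult lin_counit by (simp add: is_coalgebra_def)
qed

lemma \<phi>2_tensor_mult: "\<phi>2 (tensor_mult A u v) = tensor_mult B (\<phi>2 u) (\<phi>2 v)"
  by (rule is_linear_eqI[where x = u], (intro lin)+, rule is_linear_eqI[where x = v],
      (intro lin)+, auto simp: rename_tensor mult)

lemma \<phi>_mult_tensor: "\<phi> (mult_tensor A u) = mult_tensor B (\<phi>2 u)"
  by (rule is_linear_eqI[where x = u], (intro lin)+, auto simp: mult)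

lemma bialgebra_A: "is_bialgebra A"
proof -
  have "hcomult A (hmult A x y) = tensor_mult A (hcomult A x) (hcomult A y)" for x y
    using bialgebra_B(3) by (intro \<phi>2_inject) (simp add: comult mult \<phi>2_tensor_mult is_bialgebra_def)
  moreover have "hcomult A (hunit A) = tensor (hunit A) (hunit A)"
    using bialgebra_B(3) by (intro \<phi>2_inject) (simp add: comult unit rename_tensor is_bialgebra_def)
  ultimately show ?thesis
    using algebra_A coalgebra_A bialgebra_B(3) by (simp add: is_bialgebra_def counit mult unit)
qed

lemma hopf_A: "is_hopf_algebra A"
proof -
  from hopf obtain S where S: "is_antipode B S" by (auto simp: is_hopf_algebra_def)
  then have linS: "is_linear S" by (simp add: is_antipode_def)
  \<comment> \<open>The antipode of \<open>B\<close>, conjugated by the isomorphism.\<close>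
  let ?S = "\<lambda>x. \<psi> (S (\<phi> x))"
  have "is_linear ?S" by (intro lin lin_compose[OF linS])
  moreover have "mult_tensor A (tensor_map ?S id (hcomult A x)) = smult (hcounit A x) (hunit A)" for x
    using S by (intro \<phi>_inject)
      (simp add: \<phi>_mult_tensor \<phi>2_tensor_map[where f' = S and g' = id] comult counit unit
        is_linear_smult[OF linear_rename] is_antipode_def)
  moreover have "mult_tensor A (tensor_map id ?S (hcomult A x)) = smult (hcounit A x) (hunit A)" for x
    using S by (intro \<phi>_inject)
      (simp add: \<phi>_mult_tensor \<phi>2_tensor_map[where f' = id and g' = S] comult counit unit
        is_linear_smult[OF linear_rename] is_antipode_def)
  ultimately show ?thesis
    using bialgebra_A unfolding is_hopf_algebra_def is_antipode_def by blast
qed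

lemma hopf_iso: "is_hopf_iso A B \<phi>"
proof -
  have "bij \<phi>" by (rule o_bij[of \<psi>]) (auto simp: fun_eq_iff)
  then show ?thesis
    unfolding is_hopf_iso_def
    by (simp add: hopf_A hopf linear_rename mult unit comult[symmetric] tensor_map_rename
        counit[symmetric])
qed

end

text \<open>Renaming carries the support of a vector to its image under \<open>\<tau>\<close>, so a
  degree-preserving bijection of bases matches the homogeneous parts.\<close>

lemma rename_homogeneous:
  fixes \<tau> :: "'a \<Rightarrow> 'b"
  assumes "bij \<tau>" "\<And>a. deg' (\<tau> a) = deg a"
  shows "rename \<tau> ` homogeneous deg n = (homogeneous deg' n :: ('b \<Rightarrow>\<^sub>0 'k::field) set)"
proof -
  have inj: "inj \<tau>" using assms(1) by (rule bij_is_inj)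
  let ?\<sigma> = "inv \<tau>"
  have \<sigma>: "?\<sigma> (\<tau> a) = a" "\<tau> (?\<sigma> b) = b" for a b
    using assms(1) by (simp_all add: bij_is_inj bij_is_surj surj_f_inv_f)
  have keys: "Poly_Mapping.keys (rename \<tau> x) = \<tau> ` Poly_Mapping.keys x" for x :: "'a \<Rightarrow>\<^sub>0 'k"
  proof (intro set_eqI)
    fix b
    have "b \<in> Poly_Mapping.keys (rename \<tau> x) \<longleftrightarrow> ?\<sigma> b \<in> Poly_Mapping.keys x"
      using lookup_rename[OF inj, of x "?\<sigma> b"] by (simp add: in_keys_iff \<sigma>)
    also have "\<dots> \<longleftrightarrow> b \<in> \<tau> ` Poly_Mapping.keys x"
      using inj_image_mem_iff[OF inj, of "?\<sigma> b"] by (simp add: \<sigma>)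
    finally show "b \<in> Poly_Mapping.keys (rename \<tau> x) \<longleftrightarrow> b \<in> \<tau> ` Poly_Mapping.keys x" .
  qed
  have sub: "rename \<tau> x \<in> homogeneous deg' n \<longleftrightarrow> x \<in> homogeneous deg n" for x :: "'a \<Rightarrow>\<^sub>0 'k"
    by (simp add: homogeneous_def keys assms(2))
  show ?thesis
  proof (intro equalityI subsetI)
    fix y :: "'b \<Rightarrow>\<^sub>0 'k" assume y: "y \<in> homogeneous deg' n"
    have e: "y = rename \<tau> (rename ?\<sigma> y)" by (simp add: rename_inverse \<sigma>)
    then have "rename ?\<sigma> y \<in> homogeneous deg n" using y sub[of "rename ?\<sigma> y"] by simp
    then show "y \<in> rename \<tau> ` homogeneous deg n" using e by (rule rev_image_eqI)
  qed (use sub in auto)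
qed

section \<open>Column types of signed set compositions\<close>

text \<open>\<open>Abs_column\<close> is meaningful only away from the zero pair, which is
  guaranteed for finite nonempty blocks that omit 0.\<close>

definition block_type :: "int set \<Rightarrow> column" where
  "block_type B = Abs_column (card {x \<in> B. x > 0}, card {x \<in> B. x < 0})"

definition comp_type :: "int set list \<Rightarrow> bicomposition" where
  "comp_type F = map block_type F"

text \<open>Weaker than \<open>signed_composition\<close>, since the absolute values may be
  arbitrary. Hence the notion passes to tails and to shifted compositions, as inductions on blocks
  require.\<close>

definition signed_blocks :: "int set list \<Rightarrow> bool" where
  "signed_blocks F \<longleftrightarrow>
     set_composition (\<Union>(set F)) F \<and> finite (\<Union>(set F)) \<and> 0 \<notin> \<Union>(set F)"

lemma comp_type_simps [simp]:
  "comp_type [] = []" "comp_type (B # F) = block_type B # comp_type F"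
  by (simp_all add: comp_type_def)

lemma set_composition_Cons:
  "set_composition Z (C # H) \<longleftrightarrow> C \<noteq> {} \<and> disjnt C (\<Union>(set H)) \<and> Z = C \<union> \<Union>(set H) \<and>
     set_composition (\<Union>(set H)) H"
  by (auto simp: set_composition_def disjnt_def)

lemma set_composition_Union: "set_composition Z H \<Longrightarrow> Z = \<Union>(set H)"
  by (simp add: set_composition_def)

lemma signed_blocks_Nil [simp]: "signed_blocks []"
  by (simp add: signed_blocks_def set_composition_def)

lemma signed_blocks_Cons:
  "signed_blocks (B # F) \<longleftrightarrow>
     B \<noteq> {} \<and> finite B \<and> 0 \<notin> B \<and> disjnt B (\<Union>(set F)) \<and> signed_blocks F"
  by (auto simp: signed_blocks_def set_composition_Cons)

lemma signed_composition_blocks: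
  assumes "signed_composition n F"
  shows "signed_blocks F"
proof -
  have "finite (\<Union>(set F))"
    using assms unfolding signed_composition_iff by (meson bij_betw_finite finite_atLeastAtMost_int)
  moreover have "0 \<notin> \<Union>(set F)" using signed_composition_range[OF assms] by force
  ultimately show ?thesis using assms by (simp add: signed_blocks_def signed_composition_iff)
qed

lemma Rep_block_type:
  assumes "B \<noteq> {}" "finite B" "0 \<notin> B"
  shows "Rep_column (block_type B) = (card {x \<in> B. x > 0}, card {x \<in> B. x < 0})"
proof -
  obtain x where x: "x \<in> B" using assms by blast
  then have "x \<noteq> 0" using assms by auto
  then have "{x \<in> B. x > 0} \<noteq> {} \<or> {x \<in> B. x < 0} \<noteq> {}" using x by force
  then show ?thesis unfolding block_type_def using assms(2) by (intro Abs_column_inverse) auto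
qed

lemma block_type_Un:
  assumes A: "A \<noteq> {}" "finite A" "0 \<notin> A" and B: "B \<noteq> {}" "finite B" "0 \<notin> B"
    and AB: "disjnt A B"
  shows "block_type (A \<union> B) = block_type A + block_type B"
proof -
  have c: "card {x \<in> A \<union> B. P x} = card {x \<in> A. P x} + card {x \<in> B. P x}" for P
  proof -
    have "{x \<in> A \<union> B. P x} = {x \<in> A. P x} \<union> {x \<in> B. P x}" by blast
    moreover have "{x \<in> A. P x} \<inter> {x \<in> B. P x} = {}" using AB by (auto simp: disjnt_def)
    ultimately show ?thesis
      using A(2) B(2) card_Un_disjoint[of "{x \<in> A. P x}" "{x \<in> B. P x}"] by simp
  qed
  have "Rep_column (block_type (A \<union> B)) =
      (card {x \<in> A \<union> B. x > 0}, card {x \<in> A \<union> B. x < 0})"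
    by (rule Rep_block_type) (use A B in auto)
  also have "\<dots> = Rep_column (block_type A + block_type B)"
    by (simp only: c plus_column.rep_eq Rep_block_type[OF A] Rep_block_type[OF B] prod.case)
  finally show ?thesis by (simp only: Rep_column_inject)
qed

lemma column_degree_block_type:
  assumes "B \<noteq> {}" "finite B" "0 \<notin> B"
  shows "column_degree (block_type B) = card B"
proof -
  have "B = {x \<in> B. x > 0} \<union> {x \<in> B. x < 0}" 
    using assms(3) by (auto simp: not_less less_le)
  moreover have "card ({x \<in> B. x > 0} \<union> {x \<in> B. x < 0}) = card {x \<in> B. x > 0} + card {x \<in> B. x < 0}"
    using assms(2) by (intro card_Un_disjoint) auto
  ultimately show ?thesis
    using assms by (simp add: column_degree.rep_eq Rep_block_type)
qed

lemma bicomp_degree_comp_type: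
  "signed_blocks F \<Longrightarrow> bicomp_degree (comp_type F) = card (\<Union>(set F))"
proof (induction F)
  case (Cons B F)
  then have "finite (\<Union>(set F))" by (simp add: signed_blocks_def)
  then show ?case
    using Cons
    by (simp add: signed_blocks_Cons bicomp_degree_def column_degree_block_type card_Un_disjnt)
qed (simp add: bicomp_degree_def)

section \<open>Column types as complete invariants of orbits\<close>

lemma block_type_image:
  assumes "inj_on h B" "\<And>x. x \<in> B \<Longrightarrow> sgn (h x) = sgn x"
  shows "block_type (h ` B) = block_type B"
proof -
  have s: "(h x > 0 \<longleftrightarrow> x > 0) \<and> (h x < 0 \<longleftrightarrow> x < 0)" if "x \<in> B" for x
    using assms(2)[OF that] by (metis sgn_greater sgn_less)
  have c: "card (h ` {x \<in> B. P x}) = card {x \<in> B. P x}" for P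
    using assms(1) by (intro card_image) (auto intro: inj_on_subset)
  have "{x \<in> h ` B. x > 0} = h ` {x \<in> B. x > 0}" "{x \<in> h ` B. x < 0} = h ` {x \<in> B. x < 0}"
    using s by auto
  then show ?thesis by (simp add: block_type_def c)
qed

lemma comp_type_relabel:
  assumes "inj_on h (\<Union>(set F))" "\<And>x. x \<in> \<Union>(set F) \<Longrightarrow> sgn (h x) = sgn x"
  shows "comp_type (relabel h F) = comp_type F"
  unfolding comp_type_def relabel_def map_map comp_def
proof (intro map_cong refl block_type_image)
  show "inj_on h B" if "B \<in> set F" for B using assms(1) that by (auto intro: inj_on_subset)
  show "sgn (h x) = sgn x" if "B \<in> set F" "x \<in> B" for B x using assms(2) that by auto
qed

text \<open>Equal counts give bijections between the positive parts and between the negative parts;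
  glued together they preserve signs.\<close>

lemma block_type_eq_bij:
  assumes "A \<noteq> {}" "finite A" "0 \<notin> A" "B \<noteq> {}" "finite B" "0 \<notin> B" "block_type A = block_type B"
  obtains h where "bij_betw h A B" "\<And>x. x \<in> A \<Longrightarrow> sgn (h x) = sgn x"
proof -
  let ?p = "\<lambda>A. {x \<in> A. x > (0::int)}" and ?n = "\<lambda>A. {x \<in> A. x < (0::int)}"
  have "card (?p A) = card (?p B)" "card (?n A) = card (?n B)"
    using Rep_block_type[OF assms(1-3)] Rep_block_type[OF assms(4-6)] assms(7) by simp_all
  then obtain f g where f: "bij_betw f (?p A) (?p B)" and g: "bij_betw g (?n A) (?n B)"
    using assms finite_same_card_bij[of "?p A" "?p B"] finite_same_card_bij[of "?n A" "?n B"] by auto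
  define h where "h x = (if x > 0 then f x else g x)" for x
  have "bij_betw h (?p A) (?p B)" using f by (subst bij_betw_cong[where g = f]) (auto simp: h_def)
  moreover have "bij_betw h (?n A) (?n B)"
    using g by (subst bij_betw_cong[where g = g]) (auto simp: h_def)
  ultimately have "bij_betw h (?p A \<union> ?n A) (?p B \<union> ?n B)" by (intro bij_betw_combine) auto
  moreover have "?p A \<union> ?n A = A" "?p B \<union> ?n B = B" 
    using assms(3,6) by (auto simp: not_less less_le)
  ultimately have "bij_betw h A B" by simp
  moreover have "sgn (h x) = sgn x" if "x \<in> A" for x
  proof (cases "x > 0")
    case True
    then have "h x > 0" using bij_betwE[OF f] that by (auto simp: h_def)
    then show ?thesis using True by simp
  next
    case False
    then have "x < 0" using that assms(3) by (cases "x = 0") auto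
    then have "h x < 0" using bij_betwE[OF g] that by (auto simp: h_def)
    then show ?thesis using \<open>x < 0\<close> by simp
  qed
  ultimately show thesis by (rule that)
qed

text \<open>The sign-preserving bijections between corresponding blocks glue to one injection,
  because the blocks on either side are disjoint.\<close>

lemma comp_type_eq_relabel:
  assumes "signed_blocks F" "signed_blocks G" "comp_type F = comp_type G"
  shows "\<exists>h. inj_on h (\<Union>(set F)) \<and> (\<forall>x\<in>\<Union>(set F). sgn (h x) = sgn x) \<and> G = relabel h F"
  using assms
proof (induction F arbitrary: G)
  case Nil
  then show ?case by (auto simp: comp_type_def)
next
  case (Cons A F)
  then obtain B G' where G: "G = B # G'" by (cases G) auto
  with Cons.prems have AB: "A \<noteq> {}" "finite A" "0 \<notin> A" "B \<noteq> {}" "finite B" "0 \<notin> B"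
    "block_type A = block_type B"
    and dA: "disjnt A (\<Union>(set F))" and dB: "disjnt B (\<Union>(set G'))"
    and FG: "signed_blocks F" "signed_blocks G'" "comp_type F = comp_type G'"
    by (auto simp: signed_blocks_Cons)
  obtain f where f: "bij_betw f A B" "\<And>x. x \<in> A \<Longrightarrow> sgn (f x) = sgn x"
    using block_type_eq_bij[OF AB] by blast
  obtain g where g: "inj_on g (\<Union>(set F))" "\<And>x. x \<in> \<Union>(set F) \<Longrightarrow> sgn (g x) = sgn x"
    "G' = relabel g F"
    using Cons.IH[OF FG] by blast
  define h where "h x = (if x \<in> A then f x else g x)" for x
  have hA: "h x = f x" if "x \<in> A" for x using that by (simp add: h_def)
  have hF: "h x = g x" if "x \<in> \<Union>(set F)" for x using that dA by (auto simp: h_def disjnt_iff)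
  have imA: "h ` A = B" using f(1) hA by (simp add: bij_betw_def)
  have relF: "relabel h F = G'" unfolding g(3) using hF by (rule relabel_cong)
  have imF: "h ` \<Union>(set F) = \<Union>(set G')" using relF Union_relabel by metis
  have "inj_on h A" using f(1) hA by (simp add: bij_betw_def inj_on_def)
  moreover have "inj_on h (\<Union>(set F))" using g(1) hF by (simp add: inj_on_def)
  moreover have "h ` A \<inter> h ` \<Union>(set F) = {}" using dB by (simp only: imA imF disjnt_def)
  ultimately have "inj_on h (A \<union> \<Union>(set F))" unfolding inj_on_Un by blast
  moreover have "\<forall>x\<in>A \<union> \<Union>(set F). sgn (h x) = sgn x" using f(2) g(2) hA hF by (metis UnE)
  moreover have "G = relabel h (A # F)" using G imA relF by (simp add: relabel_def)
  ultimately show ?case by auto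
qed

text \<open>A sign-preserving relabelling keeps all counts. Conversely, equal types force equal
  degrees, hence \<open>n = m\<close>, and the relabelling built block by block lies in the
  symmetric group action by \<open>same_orbit_iff\<close>.\<close>

lemma same_orbit_iff_comp_type:
  assumes F: "signed_composition n F" and G: "signed_composition m G"
  shows "same_orbit F G \<longleftrightarrow> comp_type F = comp_type G"
proof
  assume "same_orbit F G"
  then obtain h where "inj_on h (\<Union>(set F))" "\<And>x. x \<in> \<Union>(set F) \<Longrightarrow> sgn (h x) = sgn x"
    and "G = relabel h F" unfolding same_orbit_iff by blast
  then show "comp_type F = comp_type G" using comp_type_relabel[of h F] by simp
next
  assume e: "comp_type F = comp_type G"
  have b: "signed_blocks F" "signed_blocks G" using F G signed_composition_blocks by auto
  have "n = m"
    using bicomp_degree_comp_type[OF b(1)] bicomp_degree_comp_type[OF b(2)] e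
      signed_composition_card[OF F] signed_composition_card[OF G] by simp
  then show "same_orbit F G"
    unfolding same_orbit_iff using comp_type_eq_relabel[OF b e] F G by blast
qed

lemma comp_type_standardize:
  assumes "signed_composition n F" "D = take i F \<or> D = drop i F"
  shows "comp_type (standardize D) = comp_type D"
  unfolding standardize_def
  by (rule comp_type_relabel) (use signed_composition_segment(2,3)[OF assms] in auto)

section \<open>Quasishuffles of set compositions\<close>

lemma restrict_comp_Nil [simp]: "restrict_comp [] X = []"
  by (simp add: restrict_comp_def)

lemma restrict_comp_Cons:
  "restrict_comp (C # H) X =
     (if C \<inter> X = {} then restrict_comp H X else (C \<inter> X) # restrict_comp H X)"
  by (simp add: restrict_comp_def)

lemma restrict_comp_self:
  "{} \<notin> set H \<Longrightarrow> \<Union>(set H) \<subseteq> X \<Longrightarrow> restrict_comp H X = H"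
  by (induction H) (auto simp: restrict_comp_Cons Int_absorb2)

lemma restrict_comp_disjoint:
  "\<Union>(set H) \<inter> X = {} \<Longrightarrow> restrict_comp H X = []"
  by (induction H) (auto simp: restrict_comp_Cons)

lemma restrict_comp_cong:
  assumes "\<Union>(set H) \<inter> X = \<Union>(set H) \<inter> Y"
  shows "restrict_comp H X = restrict_comp H Y"
proof -
  have "map (\<lambda>B. B \<inter> X) H = map (\<lambda>B. B \<inter> Y) H" using assms by (intro map_cong) auto
  then show ?thesis by (simp only: restrict_comp_def)
qed

lemma set_quasishuffles_Nil:
  assumes "set_composition X F"
  shows "set_quasishuffles [] F = {F}" "set_quasishuffles F [] = {F}"
proof -
  have F: "{} \<notin> set F" "X = \<Union>(set F)" using assms by (simp_all add: set_composition_def)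
  have "restrict_comp H {} = []" for H :: "'a set list" by (simp add: restrict_comp_disjoint)
  moreover have "restrict_comp H X = H" if "set_composition X H" for H
    using that by (intro restrict_comp_self) (auto simp: set_composition_def)
  ultimately show "set_quasishuffles [] F = {F}" "set_quasishuffles F [] = {F}"
    using F assms by (auto simp: set_quasishuffles_def)
qed

section \<open>Recursion on the first block\<close>

lemma set_quasishuffles_iff:
  assumes "set_composition X F" "set_composition Y G"
  shows "H \<in> set_quasishuffles F G \<longleftrightarrow>
    set_composition (X \<union> Y) H \<and> restrict_comp H X = F \<and> restrict_comp H Y = G"
  using assms by (simp add: set_quasishuffles_def set_composition_def)

text \<open>The block \<open>C\<close> meets \<open>X\<close>, \<open>Y\<close> or both. Where it
  meets one of them, the intersection is the first block of that restriction, hence \<open>A\<close>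
  or \<open>B\<close>; where it does not, that factor is left intact for \<open>H\<close>.\<close>

lemma Cons_in_set_quasishuffles:
  assumes F: "set_composition X (A # F)" and G: "set_composition Y (B # G)" and XY: "X \<inter> Y = {}"
  shows "C # H \<in> set_quasishuffles (A # F) (B # G) \<longleftrightarrow>
    C = A \<and> H \<in> set_quasishuffles F (B # G) \<or> C = B \<and> H \<in> set_quasishuffles (A # F) G \<or>
    C = A \<union> B \<and> H \<in> set_quasishuffles F G" (is "?L \<longleftrightarrow> ?R")
proof -
  obtain P where P: "set_composition P F" "X = A \<union> P" "A \<inter> P = {}" "A \<noteq> {}"
    using F by (auto simp: set_composition_Cons disjnt_def)
  obtain Q where Q: "set_composition Q G" "Y = B \<union> Q" "B \<inter> Q = {}" "B \<noteq> {}"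
    using G by (auto simp: set_composition_Cons disjnt_def)
  obtain U where U: "U = \<Union>(set H)" by blast
  have d: "A \<inter> B = {}" "A \<inter> Q = {}" "P \<inter> B = {}" "P \<inter> Q = {}" using P(2) Q(2) XY by auto
  \<comment> \<open>With \<open>s\<close> set apart, being a composition of a given set becomes an
    equation between sets.\<close>
  define s where "s \<longleftrightarrow> set_composition U H"
  have sH: "set_composition Z H \<longleftrightarrow> U = Z \<and> s" for Z
    unfolding s_def U by (auto simp: set_composition_def)
  have sCH: "set_composition Z (C # H) \<longleftrightarrow> C \<noteq> {} \<and> C \<inter> U = {} \<and> Z = C \<union> U \<and> s" for Z
    unfolding s_def U by (auto simp: set_composition_Cons disjnt_def)
  \<comment> \<open>Once the first block is removed, restricting \<open>H\<close> to
    \<open>X\<close> or to \<open>P\<close>, and to \<open>Y\<close> or to \<open>Q\<close>, can be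
    exchanged by this.\<close>
  have r: "restrict_comp H Z = restrict_comp H Z'" if "U \<inter> Z = U \<inter> Z'" for Z Z'
    using that unfolding U by (rule restrict_comp_cong)
  note iffs = set_quasishuffles_iff[OF F G] set_quasishuffles_iff[OF P(1) G]
    set_quasishuffles_iff[OF F Q(1)] set_quasishuffles_iff[OF P(1) Q(1)] sH sCH restrict_comp_Cons
  show ?thesis
  proof
    assume ?L
    then have C: "C \<noteq> {}" "C \<inter> U = {}" "X \<union> Y = C \<union> U" s
      and rX: "restrict_comp (C # H) X = A # F" and rY: "restrict_comp (C # H) Y = B # G"
      unfolding set_quasishuffles_iff[OF F G] sCH by blast+
    have P': "restrict_comp H P = F" if "C \<inter> X = A" "restrict_comp H X = F"
      using that C(2) P r[of P X] by blast
    have Q': "restrict_comp H Q = G" if "C \<inter> Y = B" "restrict_comp H Y = G"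
      using that C(2) Q r[of Q Y] by blast
    consider "C \<inter> X = {}" "C \<inter> Y \<noteq> {}" | "C \<inter> X \<noteq> {}" "C \<inter> Y = {}" | "C \<inter> X \<noteq> {}" "C \<inter> Y \<noteq> {}"
      using C(1,3) by blast
    then show ?R
    proof cases
      case 1
      then have e: "C \<inter> Y = B" "restrict_comp H Y = G" "restrict_comp H X = A # F"
        using rX rY by (simp_all add: restrict_comp_Cons)
      have "C = B" using C(3) 1 e(1) by blast
      moreover have "U = X \<union> Q" using C(2,3) \<open>C = B\<close> P(2) Q(2,3) d by blast
      ultimately show ?thesis
        using e Q' C(4) unfolding iffs by blast
    next
      case 2
      then have e: "C \<inter> X = A" "restrict_comp H X = F" "restrict_comp H Y = B # G"
        using rX rY by (simp_all add: restrict_comp_Cons)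
      have "C = A" using C(3) 2 e(1) by blast
      moreover have "U = P \<union> Y" using C(2,3) \<open>C = A\<close> P(2,3) Q(2) d by blast
      ultimately show ?thesis
        using e P' C(4) unfolding iffs by blast
    next
      case 3
      then have e: "C \<inter> X = A" "restrict_comp H X = F" "C \<inter> Y = B" "restrict_comp H Y = G"
        using rX rY by (simp_all add: restrict_comp_Cons)
      have "C = A \<union> B" using C(3) e(1,3) by blast
      moreover have "U = P \<union> Q" using C(2,3) \<open>C = A \<union> B\<close> P(2,3) Q(2,3) d by blast
      ultimately show ?thesis
        using e P' Q' C(4) unfolding iffs by blast
    qed
  next
    assume ?R
    then consider (A) "C = A" "H \<in> set_quasishuffles F (B # G)"
      | (B) "C = B" "H \<in> set_quasishuffles (A # F) G"
      | (AB) "C = A \<union> B" "H \<in> set_quasishuffles F G" by blast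
    then show ?L
    proof cases
      case A
      then have H: "U = P \<union> Y" s "restrict_comp H P = F" "restrict_comp H Y = B # G"
        unfolding iffs by blast+
      have "restrict_comp H X = F" using H(1,3) P(2,3) Q(2) d r[of X P] by blast
      moreover have "C \<inter> X = A" "C \<inter> Y = {}" "C \<inter> U = {}" "X \<union> Y = C \<union> U"
        using A(1) H(1) P(2,3) Q(2) d by blast+
      ultimately show ?thesis
        using H P(4) A(1) unfolding iffs by simp
    next
      case B
      then have H: "U = X \<union> Q" s "restrict_comp H X = A # F" "restrict_comp H Q = G"
        unfolding iffs by blast+
      have "restrict_comp H Y = G" using H(1,4) P(2) Q(2,3) d r[of Y Q] by blast
      moreover have "C \<inter> X = {}" "C \<inter> Y = B" "C \<inter> U = {}" "X \<union> Y = C \<union> U"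
        using B(1) H(1) P(2) Q(2,3) d by blast+
      ultimately show ?thesis
        using H Q(4) B(1) unfolding iffs by simp
    next
      case AB
      then have H: "U = P \<union> Q" s "restrict_comp H P = F" "restrict_comp H Q = G"
        unfolding iffs by blast+
      have "restrict_comp H X = F" "restrict_comp H Y = G"
        using H P(2,3) Q(2,3) d r[of X P] r[of Y Q] by blast+
      moreover have "C \<inter> X = A" "C \<inter> Y = B" "C \<inter> U = {}" "X \<union> Y = C \<union> U"
        using AB(1) H(1) P(2,3) Q(2,3) d by blast+
      ultimately show ?thesis
        using H P(4) Q(4) AB(1) unfolding iffs by simp
    qed
  qed
qed

lemma set_quasishuffles_Cons:
  assumes "set_composition X (A # F)" "set_composition Y (B # G)" "X \<inter> Y = {}"
  shows "set_quasishuffles (A # F) (B # G) =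
    (#) A ` set_quasishuffles F (B # G) \<union> (#) B ` set_quasishuffles (A # F) G \<union>
    (#) (A \<union> B) ` set_quasishuffles F G"
proof (rule set_eqI)
  fix H
  show "H \<in> set_quasishuffles (A # F) (B # G) \<longleftrightarrow>
    H \<in> (#) A ` set_quasishuffles F (B # G) \<union> (#) B ` set_quasishuffles (A # F) G \<union>
      (#) (A \<union> B) ` set_quasishuffles F G"
  proof (cases H)
    case Nil
    then show ?thesis by (auto simp: set_quasishuffles_def)
  next
    case (Cons C H')
    then show ?thesis using Cons_in_set_quasishuffles[OF assms, of C H'] by auto
  qed
qed

text \<open>Equality of sums for arbitrary \<open>f\<close> expresses that each bicomposition arises
  with the same multiplicity on both sides. Generality in \<open>f\<close> also lets the hypothesis
  be used with a column prepended, and finiteness is carried along in order to split the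
  sum.\<close>

lemma sum_set_quasishuffles:
  fixes f :: "bicomposition \<Rightarrow> 'm::comm_monoid_add"
  assumes "signed_blocks F" "signed_blocks G" "\<Union>(set F) \<inter> \<Union>(set G) = {}"
  shows "finite (set_quasishuffles F G) \<and> (\<Sum>H\<in>set_quasishuffles F G. f (comp_type H)) =
    sum_list (map f (quasishuffles (comp_type F) (comp_type G)))"
  using assms
proof (induction "length F + length G" arbitrary: F G f rule: less_induct)
  case less
  have sc: "set_composition (\<Union>(set F)) F" "set_composition (\<Union>(set G)) G"
    using less.prems by (auto simp: signed_blocks_def)
  show ?case
  proof (cases "F = [] \<or> G = []")
    case True
    then show ?thesis
    proof
      assume "F = []"
      then show ?thesis using set_quasishuffles_Nil(1)[OF sc(2)] by simp
    next
      assume "G = []"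
      then show ?thesis using set_quasishuffles_Nil(2)[OF sc(1)] by (cases F) simp_all
    qed
  next
    case False
    then obtain A F' B G' where e: "F = A # F'" "G = B # G'" by (meson neq_Nil_conv)
    have A: "A \<noteq> {}" "finite A" "0 \<notin> A" "signed_blocks F'"
      and B: "B \<noteq> {}" "finite B" "0 \<notin> B" "signed_blocks G'"
      using less.prems e by (auto simp: signed_blocks_Cons)
    have AB: "A \<inter> B = {}" using less.prems(3) e by auto
    let ?S1 = "set_quasishuffles F' G" and ?S2 = "set_quasishuffles F G'"
      and ?S3 = "set_quasishuffles F' G'"
    have d: "\<Union>(set F') \<inter> \<Union>(set G) = {}" "\<Union>(set F) \<inter> \<Union>(set G') = {}"
      "\<Union>(set F') \<inter> \<Union>(set G') = {}" using less.prems(3) e by auto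
    note IH1 = less.hyps[of F' G, OF _ A(4) less.prems(2) d(1)]
    note IH2 = less.hyps[of F G', OF _ less.prems(1) B(4) d(2)]
    note IH3 = less.hyps[of F' G', OF _ A(4) B(4) d(3)]
    have fin: "finite ?S1" "finite ?S2" "finite ?S3" using IH1 IH2 IH3 e by auto
    \<comment> \<open>The blocks are nonempty and disjoint, so the three kinds of quasishuffles are
      told apart by their first block and nothing is counted twice.\<close>
    have ne: "A \<noteq> B" "A \<noteq> A \<union> B" "B \<noteq> A \<union> B" using A(1) B(1) AB by auto
    have dj: "(#) C ` S \<inter> (#) D ` T = {}" if "C \<noteq> D" for C D :: "int set" and S T
      using that by blast
    have d1: "(#) A ` ?S1 \<inter> (#) B ` ?S2 = {}" by (rule dj[OF ne(1)])
    have d2: "((#) A ` ?S1 \<union> (#) B ` ?S2) \<inter> (#) (A \<union> B) ` ?S3 = {}"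
      unfolding Int_Un_distrib2 dj[OF ne(2)] dj[OF ne(3)] by simp
    have S: "set_quasishuffles F G = ((#) A ` ?S1 \<union> (#) B ` ?S2) \<union> (#) (A \<union> B) ` ?S3"
      using set_quasishuffles_Cons[OF sc[unfolded e]] less.prems(3) by (simp add: e)
    have "(\<Sum>H\<in>set_quasishuffles F G. f (comp_type H)) =
        (\<Sum>H\<in>(#) A ` ?S1. f (comp_type H)) + (\<Sum>H\<in>(#) B ` ?S2. f (comp_type H)) +
        (\<Sum>H\<in>(#) (A \<union> B) ` ?S3. f (comp_type H))"
      unfolding S
      by (simp only: sum.union_disjoint[OF finite_UnI[OF finite_imageI[OF fin(1)]
            finite_imageI[OF fin(2)]] finite_imageI[OF fin(3)] d2]
          sum.union_disjoint[OF finite_imageI[OF fin(1)] finite_imageI[OF fin(2)] d1])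
    also have "\<dots> = (\<Sum>H\<in>?S1. f (block_type A # comp_type H)) +
        (\<Sum>H\<in>?S2. f (block_type B # comp_type H)) +
        (\<Sum>H\<in>?S3. f ((block_type A + block_type B) # comp_type H))"
      using A B AB by (simp add: sum.reindex block_type_Un disjnt_def)
    also have "\<dots> = sum_list (map f (quasishuffles (comp_type F) (comp_type G)))"
      using IH1[of "\<lambda>c. f (block_type A # c)"] IH2[of "\<lambda>c. f (block_type B # c)"]
        IH3[of "\<lambda>c. f ((block_type A + block_type B) # c)"]
      by (simp add: e comp_def add.assoc)
    finally show ?thesis using S fin by simp
  qed
qed

text \<open>Induction on the columns: a block realising the first column is put on the smallest
  absolute values, in front of a shifted realisation of the rest.\<close>

lemma comp_type_surj: "\<exists>n F. signed_composition n F \<and> comp_type F = c"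
proof (induction c)
  case Nil
  then show ?case using signed_composition_Nil by force
next
  case (Cons x c)
  then obtain m G where G: "signed_composition m G" "comp_type G = c" by blast
  obtain a b where ab: "Rep_column x = (a, b)" by fastforce
  have ab0: "a > 0 \<or> b > 0" using Rep_column[of x] ab by auto
  let ?n = "a + b"
  \<comment> \<open>There are \<open>a\<close> positive elements, and \<open>b\<close> negative ones
    whose absolute values run from \<open>a + 1\<close> to \<open>a + b\<close>.\<close>
  define B where "B = {1..int a} \<union> {- int ?n..- int a - 1}"
  have B: "B \<noteq> {}" "finite B" "0 \<notin> B" using ab0 by (auto simp: B_def)
  have "{x \<in> B. x > 0} = {1..int a}" "{x \<in> B. x < 0} = {- int ?n..- int a - 1}"
    by (auto simp: B_def)
  then have "Rep_column (block_type B) = Rep_column x"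
    using Rep_block_type[OF B] ab by simp
  then have tB: "block_type B = x" by (simp add: Rep_column_inject)
  have "bij_betw abs B {1..int ?n}"
    by (rule bij_betw_byWitness[where f' = "\<lambda>j. if j \<le> int a then j else - j"]) (auto simp: B_def)
  then have cB: "signed_composition ?n [B]"
    using B(1) by (simp add: signed_composition_iff set_composition_def)
  let ?G = "relabel (signed_shift ?n) G"
  have nz: "y \<noteq> 0" if "y \<in> \<Union>(set G)" for y using signed_composition_range[OF G(1) that] by auto
  have inj: "inj_on (signed_shift ?n) (\<Union>(set G))"
    by (rule inj_on_subset[OF inj_signed_shift]) simp
  obtain V where V: "V = signed_shift ?n ` \<Union>(set G)" by blast
  have cG: "set_composition V ?G"
    unfolding V using G(1) by (intro set_composition_relabel inj) (simp add: signed_composition_iff)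
  have dis: "B \<inter> V = {}"
  proof -
    have "\<bar>y\<bar> \<le> int ?n" if "y \<in> B" for y using that by (auto simp: B_def)
    moreover have "\<bar>y\<bar> > int ?n" if y: "y \<in> V" for y
    proof -
      obtain z where z: "z \<in> \<Union>(set G)" "y = signed_shift ?n z" using y unfolding V by (rule imageE)
      then show ?thesis using nz[OF z(1)] signed_shift_props(1)[of z ?n] by simp
    qed
    ultimately show ?thesis by (meson disjoint_iff not_le)
  qed
  have cB': "set_composition B [B]" using B(1) by (simp add: set_composition_def)
  have UV: "\<Union>(set ?G) = V" using set_composition_Union[OF cG] by simp
  have "set_composition (B \<union> V) (B # ?G)"
    unfolding set_composition_Cons UV using B(1) dis cG by (simp add: disjnt_def)
  moreover have "restrict_comp (B # ?G) B = [B]"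
    using B(1) dis by (simp add: restrict_comp_Cons restrict_comp_disjoint UV Int_commute del: Union_relabel)
  moreover have "restrict_comp (B # ?G) V = ?G"
    using dis cG restrict_comp_self[of ?G V] UV
    by (simp add: restrict_comp_Cons set_composition_def del: Union_relabel)
  \<comment> \<open>Concatenation is a particular quasishuffle, so the closure of signed
    compositions under shifted quasishuffles applies.\<close>
  ultimately have "B # ?G \<in> set_quasishuffles [B] ?G"
    unfolding set_quasishuffles_iff[OF cB' cG] by blast
  then have "signed_composition (?n + m) (B # ?G)"
    by (rule signed_composition_quasishuffle[OF cB G(1)])
  moreover have "comp_type ?G = comp_type G"
    by (rule comp_type_relabel[OF inj]) (rule signed_shift_props(2)[OF nz])
  ultimately show ?case using tB G(2) by (intro exI[of _ "?n + m"] exI[of _ "B # ?G"]) simp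
qed

section \<open>The isomorphism\<close>

instance column :: semigroup_add
proof
  show "x + y + z = x + (y + z)" for x y z :: column
    by transfer auto
qed

lift_definition orbit_type :: "comp_orbit \<Rightarrow> bicomposition" is comp_type
  using same_orbit_iff same_orbit_iff_comp_type by blast

text \<open>The quotient is partial, so a representative is supplied together with the fact that it
  is a signed composition.\<close>

lemma orbit_cases:
  obtains n F where "a = abs_comp_orbit F" "signed_composition n F" "same_orbit F F"
proof (induction a rule: comp_orbit.abs_induct)
  case (1 F)
  then show ?case using same_orbit_iff by blast
qed

lemma bij_orbit_type: "bij orbit_type"
proof (rule bijI)
  show "inj orbit_type"
  proof (rule injI)
    fix a b assume e: "orbit_type a = orbit_type b"
    obtain n F where F: "a = abs_comp_orbit F" "signed_composition n F" "same_orbit F F"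
      by (rule orbit_cases)
    obtain m G where G: "b = abs_comp_orbit G" "signed_composition m G" "same_orbit G G"
      by (rule orbit_cases)
    have "comp_type F = comp_type G" using e F G by (simp add: orbit_type.abs_eq)
    then show "a = b"
      unfolding F(1) G(1) using same_orbit_iff_comp_type[OF F(2) G(2)] by (simp add: abs_comp_orbit_eq)
  qed
  show "surj orbit_type"
    unfolding surj_def
  proof
    fix c
    obtain n F where "signed_composition n F" "comp_type F = c" using comp_type_surj by blast
    then have "c = orbit_type (abs_comp_orbit F)" using same_orbit_refl orbit_type.abs_eq by metis
    then show "\<exists>a. c = orbit_type a" by blast
  qed
qed

lemma bicomp_degree_orbit_type: "bicomp_degree (orbit_type a) = orbit_degree a"
proof -
  obtain n F where F: "a = abs_comp_orbit F" "signed_composition n F" "same_orbit F F"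
    by (rule orbit_cases)
  then show ?thesis
    using bicomp_degree_comp_type[OF signed_composition_blocks]
    by (simp add: orbit_type.abs_eq orbit_degree.abs_eq)
qed

lemma orbit_type_empty_orbit: "orbit_type empty_orbit = []"
  unfolding empty_orbit_def using same_orbit_refl[OF signed_composition_Nil]
  by (simp add: orbit_type.abs_eq)

section \<open>Agreement of products and coproducts\<close>

lemma orbit_type_abs: "signed_composition n F \<Longrightarrow> orbit_type (abs_comp_orbit F) = comp_type F"
  using orbit_type.abs_eq same_orbit_refl by blast

text \<open>The shift makes the two compositions disjoint and preserves signs, so counting
  quasishuffles by type applies with \<open>f = bas\<close>.\<close>

lemma rename_orbit_mult:
  "rename orbit_type (orbit_mult a b) =
     (sum_list (map bas (quasishuffles (orbit_type a) (orbit_type b))) :: bicomposition \<Rightarrow>\<^sub>0 'k::field)"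
proof -
  obtain n F where F: "a = abs_comp_orbit F" "signed_composition n F" "same_orbit F F"
    by (rule orbit_cases)
  obtain m G where G: "b = abs_comp_orbit G" "signed_composition m G" "same_orbit G G"
    by (rule orbit_cases)
  let ?G = "relabel (signed_shift n) G"
  have nz: "y \<noteq> 0" if "y \<in> \<Union>(set G)" for y using signed_composition_range[OF G(2) that] by auto
  have inj: "inj_on (signed_shift n) (\<Union>(set G))"
    by (rule inj_on_subset[OF inj_signed_shift]) simp
  have sF: "signed_blocks F" and sG: "signed_blocks G"
    using F(2) G(2) by (auto intro: signed_composition_blocks)
  have shift: "\<bar>y\<bar> > int n" if y: "y \<in> \<Union>(set ?G)" for y
  proof -
    obtain z where z: "z \<in> \<Union>(set G)" "y = signed_shift n z"
      using y unfolding Union_relabel by (rule imageE)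
    then show ?thesis using nz[OF z(1)] signed_shift_props(1)[of z n] by simp
  qed
  have sG': "signed_blocks ?G"
  proof -
    have "set_composition (\<Union>(set ?G)) ?G"
      unfolding Union_relabel
      by (rule set_composition_relabel[OF _ inj]) (use sG in \<open>simp add: signed_blocks_def\<close>)
    moreover have "finite (\<Union>(set ?G))"
      unfolding Union_relabel by (rule finite_imageI) (use sG in \<open>simp add: signed_blocks_def\<close>)
    moreover have "0 \<notin> \<Union>(set ?G)" using shift[of 0] by auto
    ultimately show ?thesis unfolding signed_blocks_def by blast
  qed
  have dis: "\<Union>(set F) \<inter> \<Union>(set ?G) = {}"
    using signed_composition_range[OF F(2)] shift by (meson atLeastAtMost_iff disjoint_iff not_le)
  have tG: "comp_type ?G = comp_type G"
    by (rule comp_type_relabel[OF inj]) (rule signed_shift_props(2)[OF nz])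
  have "rename orbit_type (orbit_mult a b :: comp_orbit \<Rightarrow>\<^sub>0 'k) =
      (\<Sum>H\<in>set_quasishuffles F ?G. bas (orbit_type (abs_comp_orbit H)))"
    unfolding F(1) G(1) orbit_mult.abs_eq[OF F(3) G(3)] signed_composition_card[OF F(2)]
      is_linear_sum[OF linear_rename] rename_bas ..
  also have "\<dots> = (\<Sum>H\<in>set_quasishuffles F ?G. bas (comp_type H))"
    using signed_composition_quasishuffle[OF F(2) G(2)] by (intro sum.cong arg_cong[where f = bas] orbit_type_abs refl)
  also have "\<dots> = sum_list (map bas (quasishuffles (comp_type F) (comp_type G)))"
    unfolding tG[symmetric] using sum_set_quasishuffles[OF sF sG' dis] by blast
  finally show ?thesis
    unfolding F(1) G(1) orbit_type.abs_eq[OF F(3)] orbit_type.abs_eq[OF G(3)] .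
qed

text \<open>Standardization preserves column types, and taking types block by block commutes with
  \<open>take\<close> and \<open>drop\<close>.\<close>

lemma rename_orbit_comult:
  "rename (map_prod orbit_type orbit_type) (orbit_comult a) =
     (\<Sum>i\<le>length (orbit_type a). bas (take i (orbit_type a), drop i (orbit_type a)))"
proof -
  obtain n F where F: "a = abs_comp_orbit F" "signed_composition n F" "same_orbit F F"
    by (rule orbit_cases)
  have t: "orbit_type (abs_comp_orbit (standardize D)) = comp_type D"
    if "D = take i F \<or> D = drop i F" for D i
    using orbit_type_abs[OF signed_composition_segment(1)[OF F(2) that]]
      comp_type_standardize[OF F(2) that] by simp
  show ?thesis
    using F t[OF disjI1[OF refl]] t[OF disjI2[OF refl]] by (simp add: orbit_comult.abs_eq orbit_type.abs_eq is_linear_sum[OF linear_rename]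
        comp_type_def take_map drop_map)
qed

lemma DQSym_eq_quasishuffle_hopf: "DQSym = quasishuffle_hopf"
  by (simp add: DQSym_def quasishuffle_hopf_def)

lemma basis_bijection_DQLambda:
  "basis_bijection orbit_type (inv orbit_type)
     (DQLambda :: (comp_orbit, 'k::field) hopf_data) DQSym"
proof (rule basis_bijection.intro)
  show inv: "inv orbit_type (orbit_type a) = a" "orbit_type (inv orbit_type c) = c" for a c
    using bij_orbit_type by (simp_all add: bij_is_inj bij_is_surj surj_f_inv_f)
  show "is_hopf_algebra (DQSym :: (bicomposition, 'k) hopf_data)"
    unfolding DQSym_eq_quasishuffle_hopf by (rule quasishuffle_is_hopf_algebra)
  \<comment> \<open>Both counits read off the coefficient at the empty object, so they agree because
    only the empty orbit has the empty type.\<close>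
  have empty: "a = empty_orbit \<longleftrightarrow> orbit_type a = []" for a
    using bij_is_inj[OF bij_orbit_type] orbit_type_empty_orbit inj_eq by metis
  show "hcounit (DQLambda :: (comp_orbit, 'k) hopf_data) (bas a) =
      hcounit DQSym (bas (orbit_type a))" for a
    using empty[of a] by (auto simp: DQLambda_def DQSym_def lookup_bas)
qed (auto simp: DQLambda_def DQSym_def rename_orbit_mult rename_orbit_comult orbit_type_empty_orbit
    functional_lookup linear_lin_ext linear_bilin_ext
    lin_bilin_ext_left[OF lin_ident])

theorem mainTheorem8:
  shows "\<exists>\<phi>. is_hopf_iso (DQLambda :: (comp_orbit, 'k::field) hopf_data) DQSym \<phi> \<and>
    (\<forall>n. \<phi> ` homogeneous orbit_degree n = homogeneous bicomp_degree n)"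
proof (intro exI conjI allI)
  \<comment> \<open>The isomorphism sends the basis vector of an orbit to that of its column
    type.\<close>
  show "is_hopf_iso DQLambda DQSym (rename orbit_type :: (comp_orbit \<Rightarrow>\<^sub>0 'k) \<Rightarrow> _)"
    by (rule basis_bijection.hopf_iso[OF basis_bijection_DQLambda])
  show "rename orbit_type ` homogeneous orbit_degree n =
      (homogeneous bicomp_degree n :: (bicomposition \<Rightarrow>\<^sub>0 'k) set)" for n
    by (rule rename_homogeneous) (rule bij_orbit_type bicomp_degree_orbit_type)+
qed

end
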